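(* Let $K_0$ be an infinite field, $K\supseteq K_0$ a field, $R$ a semisimple $K_0$-algebra, $M$ an $R$-module of length $d$, and let $\varsigma : \operatorname{Dir}_K(K) \to \operatorname{Dir}_R(M)$ be a ($K_0$-linear) $d$-inflator. Let $L = K \cdot (a_1,\ldots,a_m)$ be a line (one-dimensional subspace) in $K^m$. Let $M' = \varsigma_m(L)$, a submodule of $M^m$. For $V \in \operatorname{Sub}_K(K^n)$, define $$\varsigma'_n(V) = \varsigma_{mn}(\xi^L_n(V)),$$ where $$\xi^L_n(V) = \{(a_1x_1, a_2x_1, \ldots, a_mx_1,\; a_1x_2, \ldots, a_mx_2,\; \ldots,\; a_1x_n, \ldots, a_mx_n) : (x_1,\ldots,x_n) \in V\} \subseteq K^{mn}.$$ Then $\varsigma'_n(V)$ is an $R$-submodule of $(M')^n \subseteq (M^m)^n = M^{mn}$ for each $n$ and each $V$, and the family $\varsigma'_\bullet$ forms a $d$-inflator $$\varsigma'_\bullet : \operatorname{Dir}_K(K) \to \operatorname{Dir}_R(M').$$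
   Context: Fix an infinite field $K_0$. For an object $A$ of a $K_0$-linear abelian category $\mathcal{C}$, $\operatorname{Sub}_{\mathcal{C}}(A^n)$ is the modular lattice of subobjects of $A^n$. The directory $\operatorname{Dir}_{\mathcal{C}}(A)$ is the multi-sorted structure $(\operatorname{Sub}_{\mathcal{C}}(A^n))_{n\ge1}$ with the lattice structure on each sort, the maps $\oplus: \operatorname{Sub}(A^n)\times\operatorname{Sub}(A^m)\to\operatorname{Sub}(A^{n+m})$, and the action of $GL_n(K_0)$ on $\operatorname{Sub}(A^n)$. A directory is any structure isomorphic to one of this form. If $\mathcal{C}$ is the category of left modules over a $K_0$-algebra $R$, one writes $\operatorname{Sub}_R$, $\operatorname{Dir}_R$. A morphism of directories $f:D_\bullet\to D'_\bullet$ is a family of maps $f_n:D_n\to D'_n$, each order-preserving and $GL_n(K_0)$-equivariant, with $f_{n+m}(x\oplus y)=f_n(x)\oplus f_m(y)$ (the lattice operations need not be preserved). "Semisimple" means semisimple of finite length. A directory $\operatorname{Dir}_{\mathcal{C}}(B)$ is semisimple of length $d$ if $B$ is semisimple of length $d$. For a field $K\supseteq K_0$, a $d$-inflator on $K$ is a morphism of directories $\varsigma:\operatorname{Dir}_K(K)\to D_\bullet$, where $D_\bullet$ is semisimple of length $d$, such that $\ell(\varsigma_n(V))=d\cdot\dim_K(V)$ for all $n$ and all $V\in\operatorname{Sub}_K(K^n)$; here $\ell$ denotes length. The subspace $\xi^L_n(V)$ may be thought of as $V\otimes L\subseteq K^n\otimes K^m$, and depends only on $L$ and $V$, not on the choice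 of $(a_1,\dots,a_m)$. *)

theory Defs
  imports "Jordan_Normal_Form.Missing_VectorSpace" "HOL-Algebra.Subrings" "HOL-Library.Extended_Nat"
begin

text \<open>
  Left modules over rings that need not be commutative. (The locale of the same shape in
  HOL-Algebra requires a commutative ring.) Submodules are those of HOL-Algebra; the name is
  qualified throughout because the VectorSpace entry has its own, commutative, version.
\<close>

locale left_module = R?: ring R + M?: abelian_group M
  for R :: "('r, 'p) ring_scheme" and M :: "('r, 'm, 'q) module_scheme" (structure) +
  assumes smult_closed [simp, intro]:
      "\<lbrakk> a \<in> carrier R; x \<in> carrier M \<rbrakk> \<Longrightarrow> a \<odot>\<^bsub>M\<^esub> x \<in> carrier M"
    and smult_l_distr:
      "\<lbrakk> a \<in> carrier R; b \<in> carrier R; x \<in> carrier M \<rbrakk> \<Longrightarrow>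
       (a \<oplus>\<^bsub>R\<^esub> b) \<odot>\<^bsub>M\<^esub> x = a \<odot>\<^bsub>M\<^esub> x \<oplus>\<^bsub>M\<^esub> b \<odot>\<^bsub>M\<^esub> x"
    and smult_r_distr:
      "\<lbrakk> a \<in> carrier R; x \<in> carrier M; y \<in> carrier M \<rbrakk> \<Longrightarrow>
       a \<odot>\<^bsub>M\<^esub> (x \<oplus>\<^bsub>M\<^esub> y) = a \<odot>\<^bsub>M\<^esub> x \<oplus>\<^bsub>M\<^esub> a \<odot>\<^bsub>M\<^esub> y"
    and smult_assoc:
      "\<lbrakk> a \<in> carrier R; b \<in> carrier R; x \<in> carrier M \<rbrakk> \<Longrightarrow>
       (a \<otimes>\<^bsub>R\<^esub> b) \<odot>\<^bsub>M\<^esub> x = a \<odot>\<^bsub>M\<^esub> (b \<odot>\<^bsub>M\<^esub> x)"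
    and smult_one [simp]:
      "x \<in> carrier M \<Longrightarrow> \<one>\<^bsub>R\<^esub> \<odot>\<^bsub>M\<^esub> x = x"

definition Sub :: "('r, 'p) ring_scheme \<Rightarrow> ('r, 'm, 'q) module_scheme \<Rightarrow> 'm set set" where
  "Sub R M = {N. Module.submodule N R M}"

definition regular_module :: "('r, 'p) ring_scheme \<Rightarrow> ('r, 'r) module" where
  "regular_module R =
     \<lparr>carrier = carrier R, mult = mult R, one = \<one>\<^bsub>R\<^esub>, zero = \<zero>\<^bsub>R\<^esub>, add = add R,
      smult = mult R\<rparr>"

text \<open>
  The power \<open>M\<^sup>n\<close> consists of the lists of length \<open>n\<close>. The ring multiplication and unit of the
  module record are irrelevant.
\<close>

definition power_module :: "('r, 'm, 'q) module_scheme \<Rightarrow> nat \<Rightarrow> ('r, 'm list) module" where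
  "power_module M n =
     \<lparr>carrier = {xs. length xs = n \<and> set xs \<subseteq> carrier M}, mult = undefined, one = undefined,
      zero = replicate n \<zero>\<^bsub>M\<^esub>, add = map2 (add M), smult = (\<lambda>r. map (smult M r))\<rparr>"

definition simple_module :: "('r, 'p) ring_scheme \<Rightarrow> ('r, 'm, 'q) module_scheme \<Rightarrow> bool" where
  "simple_module R M \<longleftrightarrow> carrier M \<noteq> {\<zero>\<^bsub>M\<^esub>} \<and> Sub R M = {{\<zero>\<^bsub>M\<^esub>}, carrier M}"

text \<open>
  Semisimple of finite length: the internal direct sum of finitely many simple submodules
  (the zero module being the empty sum).
\<close>

definition semisimple_module :: "('r, 'p) ring_scheme \<Rightarrow> ('r, 'm, 'q) module_scheme \<Rightarrow> bool" where
  "semisimple_module R M \<longleftrightarrow>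
     (\<exists>k S. (\<forall>i<(k::nat). S i \<in> Sub R M \<and> simple_module R (M\<lparr>carrier := S i\<rparr>)) \<and>
            (\<forall>x\<in>carrier M. \<exists>!s. s \<in> (\<Pi>\<^sub>E i\<in>{..<k}. S i) \<and> x = finsum M s {..<k}))"

definition semisimple_ring :: "('r, 'p) ring_scheme \<Rightarrow> bool" where
  "semisimple_ring R \<longleftrightarrow> ring R \<and> semisimple_module R (regular_module R)"

definition module_length :: "('r, 'p) ring_scheme \<Rightarrow> ('r, 'm, 'q) module_scheme \<Rightarrow> enat" where
  "module_length R M =
     Sup {enat k | k. \<exists>N. (\<forall>i\<le>k. N i \<in> Sub R M) \<and> (\<forall>i<k. N i \<subset> N (Suc i))}"

text \<open>
  \<open>R\<close> is an algebra over the field \<open>F\<close> via the structure map \<open>\<phi>\<close>, whose image is central.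
\<close>

definition algebra_over ::
  "('k, 'p) ring_scheme \<Rightarrow> ('k \<Rightarrow> 'r) \<Rightarrow> ('r, 'q) ring_scheme \<Rightarrow> bool" where
  "algebra_over F \<phi> R \<longleftrightarrow> field F \<and> ring R \<and> \<phi> \<in> ring_hom F R \<and>
     (\<forall>c\<in>carrier F. \<forall>r\<in>carrier R. \<phi> c \<otimes>\<^bsub>R\<^esub> r = r \<otimes>\<^bsub>R\<^esub> \<phi> c)"

text \<open>
  A square matrix of size \<open>n\<close> is a function of two indices, used only below \<open>n\<close>.
\<close>

definition matrices :: "('k, 'p) ring_scheme \<Rightarrow> nat \<Rightarrow> (nat \<Rightarrow> nat \<Rightarrow> 'k) set" where
  "matrices F n = {A. \<forall>i<n. \<forall>j<n. A i j \<in> carrier F}"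

definition mutually_inverse ::
  "('k, 'p) ring_scheme \<Rightarrow> nat \<Rightarrow> (nat \<Rightarrow> nat \<Rightarrow> 'k) \<Rightarrow> (nat \<Rightarrow> nat \<Rightarrow> 'k) \<Rightarrow> bool" where
  "mutually_inverse F n A B \<longleftrightarrow> (\<forall>i<n. \<forall>j<n.
     (\<Oplus>\<^bsub>F\<^esub>k\<in>{..<n}. A i k \<otimes>\<^bsub>F\<^esub> B k j) = (if i = j then \<one>\<^bsub>F\<^esub> else \<zero>\<^bsub>F\<^esub>) \<and>
     (\<Oplus>\<^bsub>F\<^esub>k\<in>{..<n}. B i k \<otimes>\<^bsub>F\<^esub> A k j) = (if i = j then \<one>\<^bsub>F\<^esub> else \<zero>\<^bsub>F\<^esub>))"

definition GL :: "nat \<Rightarrow> ('k, 'p) ring_scheme \<Rightarrow> (nat \<Rightarrow> nat \<Rightarrow> 'k) set" where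
  "GL n F = {A \<in> matrices F n. \<exists>B \<in> matrices F n. mutually_inverse F n A B}"

definition mat_vec ::
  "('k \<Rightarrow> 'r) \<Rightarrow> ('r, 'm, 'q) module_scheme \<Rightarrow> nat \<Rightarrow> (nat \<Rightarrow> nat \<Rightarrow> 'k) \<Rightarrow> 'm list \<Rightarrow> 'm list" where
  "mat_vec \<phi> M n A v = map (\<lambda>i. \<Oplus>\<^bsub>M\<^esub>j\<in>{..<n}. \<phi> (A i j) \<odot>\<^bsub>M\<^esub> (v ! j)) [0..<n]"

text \<open>
  The multi-sorted structure underlying a directory. The sorts are ordered sets in the sense of
  HOL-Algebra, their lattice operations being determined by the order; only the sorts with index
  at least \<open>1\<close> count.
\<close>

record ('k, 'x) directory =
  sort :: "nat \<Rightarrow> 'x gorder"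
  osum :: "nat \<Rightarrow> nat \<Rightarrow> 'x \<Rightarrow> 'x \<Rightarrow> 'x"
  gl_action :: "nat \<Rightarrow> (nat \<Rightarrow> nat \<Rightarrow> 'k) \<Rightarrow> 'x \<Rightarrow> 'x"

text \<open>
  The directory of an \<open>R\<close>-module \<open>M\<close>, where \<open>R\<close> is an algebra with structure map \<open>\<phi>\<close>.
\<close>

definition Dir ::
  "('k \<Rightarrow> 'r) \<Rightarrow> ('r, 'p) ring_scheme \<Rightarrow> ('r, 'm, 'q) module_scheme \<Rightarrow> ('k, 'm list set) directory" where
  "Dir \<phi> R M =
     \<lparr>sort = (\<lambda>n. \<lparr>carrier = Sub R (power_module M n), eq = (=), le = (\<subseteq>)\<rparr>),
      osum = (\<lambda>n m X Y. {x @ y | x y. x \<in> X \<and> y \<in> Y}),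
      gl_action = (\<lambda>n A X. mat_vec \<phi> M n A ` X)\<rparr>"

definition directory_morphism ::
  "('k, 'p) ring_scheme \<Rightarrow> ('k, 'x) directory \<Rightarrow> ('k, 'y) directory \<Rightarrow> (nat \<Rightarrow> 'x \<Rightarrow> 'y) \<Rightarrow> bool" where
  "directory_morphism F D D' f \<longleftrightarrow>
     (\<forall>n\<ge>1. f n \<in> carrier (sort D n) \<rightarrow> carrier (sort D' n) \<and>
             isotone (sort D n) (sort D' n) (f n)) \<and>
     (\<forall>n\<ge>1. \<forall>A\<in>GL n F. \<forall>x\<in>carrier (sort D n).
        f n (gl_action D n A x) = gl_action D' n A (f n x)) \<and>
     (\<forall>n\<ge>1. \<forall>m\<ge>1. \<forall>x\<in>carrier (sort D n). \<forall>y\<in>carrier (sort D m).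
        f (n + m) (osum D n m x y) = osum D' n m (f n x) (f m y))"

text \<open>
  The directory of \<open>K\<close> as a vector space over itself and \<open>K\<^sub>0\<close>-algebra, for a subfield \<open>K\<^sub>0\<close>.
\<close>

abbreviation vec_space :: "('k, 'p) ring_scheme \<Rightarrow> nat \<Rightarrow> ('k, 'k list) module" where
  "vec_space K n \<equiv> power_module (regular_module K) n"

abbreviation Dir_field :: "('k, 'p) ring_scheme \<Rightarrow> ('k, 'k list set) directory" where
  "Dir_field K \<equiv> Dir (\<lambda>c. c) K (regular_module K)"

definition inflator ::
  "'k set \<Rightarrow> ('k, 'p) ring_scheme \<Rightarrow> ('k \<Rightarrow> 'r) \<Rightarrow> ('r, 'q) ring_scheme \<Rightarrow>
   ('r, 'm, 's) module_scheme \<Rightarrow> nat \<Rightarrow> (nat \<Rightarrow> 'k list set \<Rightarrow> 'm list set) \<Rightarrow> bool" where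
  "inflator K\<^sub>0 K \<phi> R M d \<zeta> \<longleftrightarrow>
     field K \<and> subfield K\<^sub>0 K \<and> algebra_over (K\<lparr>carrier := K\<^sub>0\<rparr>) \<phi> R \<and>
     left_module R M \<and> semisimple_module R M \<and> module_length R M = enat d \<and>
     directory_morphism (K\<lparr>carrier := K\<^sub>0\<rparr>) (Dir_field K) (Dir \<phi> R M) \<zeta> \<and>
     (\<forall>n\<ge>1. \<forall>V\<in>Sub K (vec_space K n).
        module_length R ((power_module M n)\<lparr>carrier := \<zeta> n V\<rparr>) =
        enat (d * vectorspace.dim K ((vec_space K n)\<lparr>carrier := V\<rparr>)))"

text \<open>
  \<open>line_tensor K a V\<close> is \<open>V \<otimes> L\<close> for the line \<open>L = K \<cdot> a\<close>, the coordinates being ordered as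
  \<open>(a\<^sub>1 x\<^sub>1, \<dots>, a\<^sub>m x\<^sub>1, \<dots>, a\<^sub>1 x\<^sub>n, \<dots>, a\<^sub>m x\<^sub>n)\<close>.
\<close>

definition line_tensor :: "('k, 'p) ring_scheme \<Rightarrow> 'k list \<Rightarrow> 'k list set \<Rightarrow> 'k list set" where
  "line_tensor K a V = (\<lambda>x. concat (map (\<lambda>x\<^sub>i. map (\<lambda>a\<^sub>j. a\<^sub>j \<otimes>\<^bsub>K\<^esub> x\<^sub>i) a) x)) ` V"

text \<open>
  \<open>(M\<^sup>m)\<^sup>n\<close> consists of lists of lists and is identified with \<open>M\<^bsup>mn\<^esup>\<close> through \<open>concat\<close>;
  \<open>regroup\<close> carries a subset of the latter to the former.
\<close>

definition regroup ::
  "('r, 'm, 'q) module_scheme \<Rightarrow> nat \<Rightarrow> nat \<Rightarrow> 'm list set \<Rightarrow> 'm list list set" where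
  "regroup M m n X = {vs \<in> carrier (power_module (power_module M m) n). concat vs \<in> X}"

lemma bij_betw_concat_power_module:
  "bij_betw concat (carrier (power_module (power_module M m) n)) (carrier (power_module M (m * n)))"
proof (induction n)
  case 0
  show ?case by (auto simp: power_module_def bij_betw_def inj_on_def)
next
  case (Suc n)
  let ?A = "\<lambda>n. carrier (power_module (power_module M m) n)"
  have len: "length (concat vs) = m * n" if "vs \<in> ?A n" for vs n
    using that by (induction vs arbitrary: n) (auto simp: power_module_def)
  have "inj_on concat (?A (Suc n))"
    by (rule inj_onI, rule concat_injective)
       (fastforce simp: power_module_def dest: set_zip_leftD set_zip_rightD)+
  moreover have "concat ` ?A (Suc n) = carrier (power_module M (m * Suc n))"
  proof (intro equalityI subsetI)
    fix xs assume "xs \<in> concat ` ?A (Suc n)"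
    then obtain vs where vs: "vs \<in> ?A (Suc n)" "xs = concat vs" by blast
    then show "xs \<in> carrier (power_module M (m * Suc n))"
      using len[OF vs(1)] by (fastforce simp: power_module_def)
  next
    fix xs assume xs: "xs \<in> carrier (power_module M (m * Suc n))"
    then have "drop m xs \<in> carrier (power_module M (m * n))"
      by (auto simp: power_module_def dest: in_set_dropD)
    then obtain vs where vs: "vs \<in> ?A n" "concat vs = drop m xs"
      using Suc.IH unfolding bij_betw_def by (metis imageE)
    have "take m xs # vs \<in> ?A (Suc n)" "concat (take m xs # vs) = xs"
      using vs xs by (auto simp: power_module_def dest: in_set_takeD)
    then show "xs \<in> concat ` ?A (Suc n)" by (metis imageI)
  qed
  ultimately show ?case by (simp add: bij_betw_def)
qed

definition mutation ::
  "('k, 'p) ring_scheme \<Rightarrow> ('r, 'm, 'q) module_scheme \<Rightarrow> nat \<Rightarrow> 'k list \<Rightarrow>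
   (nat \<Rightarrow> 'k list set \<Rightarrow> 'm list set) \<Rightarrow> nat \<Rightarrow> 'k list set \<Rightarrow> 'm list list set" where
  "mutation K M m a \<zeta> n V = regroup M m n (\<zeta> (m * n) (line_tensor K a V))"

end

theory Submission
  imports Defs
begin

text \<open>
  The line \<open>L = K a\<close> is the image of the injective linear map \<open>c \<mapsto> c a\<close> from \<open>K\<close> to \<open>K\<^sup>m\<close>, so
  \<open>V \<mapsto> V \<otimes> L\<close> is the image under an injective linear map \<open>K\<^sup>n \<rightarrow> (K\<^sup>m)\<^sup>n = K\<^bsup>mn\<^esup>\<close>. Hence it preserves
  inclusions, dimensions and direct sums, and it turns the action of \<open>A\<close> into that of the Kronecker
  product of \<open>A\<close> with the identity. All clauses for the mutation follow by transporting those for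
  \<open>\<zeta>\<close> along \<open>(M\<^sup>m)\<^sup>n = M\<^bsup>mn\<^esup>\<close>; since \<open>K\<^sup>n \<otimes> L\<close> is the direct sum of \<open>n\<close> copies of \<open>L\<close>, compatibility
  with direct sums gives \<open>\<zeta>(K\<^sup>n \<otimes> L) = (M')\<^sup>n\<close>, and monotonicity puts every \<open>\<zeta>(V \<otimes> L)\<close> inside it.
  The length of \<open>M'\<close> is \<open>d \<cdot> dim L = d\<close>, and \<open>M'\<close> is semisimple as a submodule of \<open>M\<^sup>m\<close>.
\<close>

section \<open>Left modules and their homomorphisms\<close>

lemma power_module_simps [simp]:
  "carrier (power_module M n) = {xs. length xs = n \<and> set xs \<subseteq> carrier M}"
  "\<zero>\<^bsub>power_module M n\<^esub> = replicate n \<zero>\<^bsub>M\<^esub>"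
  "add (power_module M n) = map2 (add M)"
  "smult (power_module M n) = (\<lambda>r. map (smult M r))"
  by (simp_all add: power_module_def)

lemma regular_module_simps [simp]:
  "carrier (regular_module R) = carrier R"
  "\<zero>\<^bsub>regular_module R\<^esub> = \<zero>\<^bsub>R\<^esub>"
  "add (regular_module R) = add R"
  "smult (regular_module R) = mult R"
  by (simp_all add: regular_module_def)

context left_module
begin

lemma smult_l_null [simp]: "x \<in> carrier M \<Longrightarrow> \<zero>\<^bsub>R\<^esub> \<odot>\<^bsub>M\<^esub> x = \<zero>\<^bsub>M\<^esub>"
  using smult_l_distr[of "\<zero>\<^bsub>R\<^esub>" "\<zero>\<^bsub>R\<^esub>" x] by simp

lemma smult_r_null [simp]: "r \<in> carrier R \<Longrightarrow> r \<odot>\<^bsub>M\<^esub> \<zero>\<^bsub>M\<^esub> = \<zero>\<^bsub>M\<^esub>"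
  using smult_r_distr[of r "\<zero>\<^bsub>M\<^esub>" "\<zero>\<^bsub>M\<^esub>"] by simp

lemma smult_minus_one: "x \<in> carrier M \<Longrightarrow> (\<ominus>\<^bsub>R\<^esub> \<one>\<^bsub>R\<^esub>) \<odot>\<^bsub>M\<^esub> x = \<ominus>\<^bsub>M\<^esub> x"
  using smult_l_distr[of "\<ominus>\<^bsub>R\<^esub> \<one>\<^bsub>R\<^esub>" "\<one>\<^bsub>R\<^esub>" x]
  by (simp add: R.l_neg M.minus_equality)

text \<open>The library notion of submodule also asks for closure under additive inverses. These are
  multiples by the scalar -1, so closure under zero, sums and scalars is enough.\<close>

lemma Sub_iff:
  "N \<in> Sub R M \<longleftrightarrow> N \<subseteq> carrier M \<and> \<zero>\<^bsub>M\<^esub> \<in> N \<and> (\<forall>x\<in>N. \<forall>y\<in>N. x \<oplus>\<^bsub>M\<^esub> y \<in> N) \<and>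
     (\<forall>r\<in>carrier R. \<forall>x\<in>N. r \<odot>\<^bsub>M\<^esub> x \<in> N)" (is "_ \<longleftrightarrow> ?closed N")
proof
  assume "N \<in> Sub R M"
  then interpret N: Module.submodule N R M by (simp add: Sub_def)
  show "?closed N" using N.subset N.one_closed N.m_closed by auto
next
  assume N: "?closed N"
  have "\<ominus>\<^bsub>M\<^esub> x \<in> N" if "x \<in> N" for x
    using N that smult_minus_one[of x] R.a_inv_closed[OF R.one_closed] by (metis subsetD)
  with N show "N \<in> Sub R M"
    unfolding Sub_def a_inv_def
    by (auto intro!: Module.submodule.intro subgroup.intro submodule_axioms.intro)
qed

lemma Sub_minus:
  assumes "N \<in> Sub R M" "x \<in> N"
  shows "\<ominus>\<^bsub>M\<^esub> x \<in> N"
proof -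
  interpret N: Module.submodule N R M using assms(1) by (simp add: Sub_def)
  show ?thesis using N.m_inv_closed[OF assms(2)] by (simp add: a_inv_def)
qed

lemma carrier_Sub: "carrier M \<in> Sub R M"
  by (simp add: Sub_iff)

lemma zero_Sub: "{\<zero>\<^bsub>M\<^esub>} \<in> Sub R M"
  by (simp add: Sub_iff)

lemma Int_Sub: "A \<in> Sub R M \<Longrightarrow> B \<in> Sub R M \<Longrightarrow> A \<inter> B \<in> Sub R M"
  by (auto simp: Sub_iff)

lemma left_module_restrict:
  assumes "N \<in> Sub R M"
  shows "left_module R (M\<lparr>carrier := N\<rparr>)"
proof -
  have N: "N \<subseteq> carrier M" "\<zero>\<^bsub>M\<^esub> \<in> N" "\<And>x y. x \<in> N \<Longrightarrow> y \<in> N \<Longrightarrow> x \<oplus>\<^bsub>M\<^esub> y \<in> N"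
    "\<And>r x. r \<in> carrier R \<Longrightarrow> x \<in> N \<Longrightarrow> r \<odot>\<^bsub>M\<^esub> x \<in> N"
    using assms Sub_iff by auto
  have "\<exists>y\<in>N. y \<oplus>\<^bsub>M\<^esub> x = \<zero>\<^bsub>M\<^esub>" if "x \<in> N" for x
    using that Sub_minus[OF assms that] N(1) M.l_neg by blast
  then have "abelian_group (M\<lparr>carrier := N\<rparr>)"
    using N by (intro abelian_groupI) (auto simp: M.a_ac subset_iff)
  moreover have "left_module_axioms R (M\<lparr>carrier := N\<rparr>)"
    using N by unfold_locales (auto simp: smult_l_distr smult_r_distr smult_assoc subset_iff)
  ultimately show ?thesis
    by (intro left_module.intro) (use R.ring_axioms in auto)
qed

lemma Sub_restrict:
  assumes "N \<in> Sub R M"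
  shows "Sub R (M\<lparr>carrier := N\<rparr>) = {B \<in> Sub R M. B \<subseteq> N}"
proof -
  interpret N: left_module R "M\<lparr>carrier := N\<rparr>" by (rule left_module_restrict[OF assms])
  have "N \<subseteq> carrier M" using assms by (simp add: Sub_iff)
  then have "B \<in> Sub R (M\<lparr>carrier := N\<rparr>) \<longleftrightarrow> B \<in> Sub R M \<and> B \<subseteq> N" for B
    unfolding N.Sub_iff Sub_iff by auto
  then show ?thesis by blast
qed

lemma left_module_power: "left_module R (power_module M n)"
proof -
  let ?P = "power_module M n"
  have nth: "xs ! i \<in> carrier M" if "set xs \<subseteq> carrier M" "i < length xs" for xs i
    using that nth_mem by blast
  have "abelian_group ?P"
  proof (rule abelian_groupI)
    fix x y assume "x \<in> carrier ?P" "y \<in> carrier ?P"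
    then show "x \<oplus>\<^bsub>?P\<^esub> y \<in> carrier ?P" by (auto simp: in_set_conv_nth nth)
  next
    fix x y z assume "x \<in> carrier ?P" "y \<in> carrier ?P" "z \<in> carrier ?P"
    then show "x \<oplus>\<^bsub>?P\<^esub> y \<oplus>\<^bsub>?P\<^esub> z = x \<oplus>\<^bsub>?P\<^esub> (y \<oplus>\<^bsub>?P\<^esub> z)"
      by (auto intro!: nth_equalityI simp: M.a_assoc nth)
  next
    fix x y assume "x \<in> carrier ?P" "y \<in> carrier ?P"
    then show "x \<oplus>\<^bsub>?P\<^esub> y = y \<oplus>\<^bsub>?P\<^esub> x"
      by (auto intro!: nth_equalityI M.a_comm simp: nth)
  next
    fix x assume "x \<in> carrier ?P"
    then show "\<exists>y\<in>carrier ?P. y \<oplus>\<^bsub>?P\<^esub> x = \<zero>\<^bsub>?P\<^esub>"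
      by (intro bexI[of _ "map (a_inv M) x"]) (auto intro!: nth_equalityI simp: M.l_neg nth)
  qed (auto intro!: nth_equalityI simp: nth)
  moreover have "left_module_axioms R ?P"
    by unfold_locales
      (auto intro!: nth_equalityI simp: smult_l_distr smult_r_distr smult_assoc nth)
  ultimately show ?thesis
    by (intro left_module.intro) (use R.ring_axioms in auto)
qed

lemma Sub_finsum:
  assumes "N \<in> Sub R M" "f \<in> A \<rightarrow> N"
  shows "finsum M f A \<in> N"
  using assms(2)
proof (induction A rule: infinite_finite_induct)
  case (insert x A)
  with assms(1) have "f \<in> A \<rightarrow> carrier M" "f x \<in> carrier M" by (auto simp: Sub_iff)
  with insert assms(1) show ?case by (auto simp: Sub_iff)
qed (use assms in \<open>auto simp: Sub_iff\<close>)

text \<open>\<open>finsum\<close> refers to the carrier of its record, so a smaller carrier could in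
  principle change its value. Here it does not, since all terms and partial sums stay in
  \<open>N\<close>.\<close>

lemma finsum_restrict:
  assumes "N \<in> Sub R M" "f \<in> A \<rightarrow> N"
  shows "finsum (M\<lparr>carrier := N\<rparr>) f A = finsum M f A"
proof -
  interpret N: left_module R "M\<lparr>carrier := N\<rparr>" by (rule left_module_restrict[OF assms(1)])
  have "N \<subseteq> carrier M" using assms(1) by (simp add: Sub_iff)
  then show ?thesis using assms(2)
  proof (induction A rule: infinite_finite_induct)
    case (insert x A)
    then have "f \<in> A \<rightarrow> carrier M" "f x \<in> carrier M" by auto
    with insert show ?case by (auto simp: N.finsum_insert)
  qed auto
qed

end

lemma (in ring) left_module_regular: "left_module R (regular_module R)"
proof -
  have "abelian_group (regular_module R)"
    using l_neg by (intro abelian_groupI) (auto simp: a_ac)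
  then show ?thesis
    by (intro left_module.intro left_module_axioms.intro ring_axioms)
      (auto simp: l_distr r_distr m_assoc)
qed

text \<open>Bridge to the commutative locale in which spans and \<open>dim\<close> are
  developed.\<close>

lemma (in left_module) vectorspaceI:
  assumes "field R"
  shows "vectorspace R M"
proof -
  interpret field R by fact
  show ?thesis by unfold_locales (auto simp: smult_l_distr smult_r_distr smult_assoc)
qed

section \<open>Homomorphisms, and the invariance of length and dimension\<close>

locale left_module_hom = M: left_module R M + N: left_module R N
  for R and M and N +
  fixes f
  assumes closed [simp]: "x \<in> carrier M \<Longrightarrow> f x \<in> carrier N"
    and add: "x \<in> carrier M \<Longrightarrow> y \<in> carrier M \<Longrightarrow> f (x \<oplus>\<^bsub>M\<^esub> y) = f x \<oplus>\<^bsub>N\<^esub> f y"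
    and smult: "r \<in> carrier R \<Longrightarrow> x \<in> carrier M \<Longrightarrow> f (r \<odot>\<^bsub>M\<^esub> x) = r \<odot>\<^bsub>N\<^esub> f x"
begin

lemma zero [simp]: "f \<zero>\<^bsub>M\<^esub> = \<zero>\<^bsub>N\<^esub>"
  using add[of "\<zero>\<^bsub>M\<^esub>" "\<zero>\<^bsub>M\<^esub>"] by simp

lemma finsum: "g \<in> A \<rightarrow> carrier M \<Longrightarrow> f (finsum M g A) = finsum N (\<lambda>i. f (g i)) A"
proof (induction A rule: infinite_finite_induct)
  case (insert x A)
  then have "g \<in> A \<rightarrow> carrier M" "g x \<in> carrier M" "(\<lambda>i. f (g i)) \<in> A \<rightarrow> carrier N"
    by (auto simp: Pi_iff)
  with insert show ?case by (simp add: add)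
qed auto

lemma image_Sub:
  assumes "A \<in> Sub R M"
  shows "f ` A \<in> Sub R N"
proof -
  have A: "A \<subseteq> carrier M" "\<zero>\<^bsub>M\<^esub> \<in> A" "\<And>x y. x \<in> A \<Longrightarrow> y \<in> A \<Longrightarrow> x \<oplus>\<^bsub>M\<^esub> y \<in> A"
    "\<And>r x. r \<in> carrier R \<Longrightarrow> x \<in> A \<Longrightarrow> r \<odot>\<^bsub>M\<^esub> x \<in> A"
    using assms by (auto simp: M.Sub_iff)
  have "f x \<oplus>\<^bsub>N\<^esub> f y \<in> f ` A" if "x \<in> A" "y \<in> A" for x y
    using that A(1,3) add[of x y, symmetric] by (auto simp: subset_iff)
  moreover have "r \<odot>\<^bsub>N\<^esub> f x \<in> f ` A" if "x \<in> A" "r \<in> carrier R" for r x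
    using that A(1,4) smult[of r x, symmetric] by (auto simp: subset_iff)
  moreover have "\<zero>\<^bsub>N\<^esub> \<in> f ` A" using imageI[OF A(2), of f] by simp
  ultimately show ?thesis using A(1) by (auto simp: N.Sub_iff)
qed

lemma vimage_Sub: "B \<in> Sub R N \<Longrightarrow> {x \<in> carrier M. f x \<in> B} \<in> Sub R M"
  by (auto simp: N.Sub_iff M.Sub_iff add smult)

lemma restrict:
  assumes "A \<in> Sub R M" "B \<in> Sub R N" "f ` A \<subseteq> B"
  shows "left_module_hom R (M\<lparr>carrier := A\<rparr>) (N\<lparr>carrier := B\<rparr>) f"
proof -
  have "A \<subseteq> carrier M" using assms by (simp add: M.Sub_iff)
  then show ?thesis
    using assms
    by (intro left_module_hom.intro left_module_hom_axioms.intro M.left_module_restrict N.left_module_restrict)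
       (auto simp: add smult subset_iff)
qed

lemma restrict_domain: "A \<in> Sub R M \<Longrightarrow> left_module_hom R (M\<lparr>carrier := A\<rparr>) N f"
  by (intro left_module_hom.intro left_module_hom_axioms.intro M.left_module_restrict N.left_module_axioms)
     (auto simp: add smult subset_iff M.Sub_iff)

lemma inv_hom:
  assumes bij: "bij_betw f (carrier M) (carrier N)"
  shows "left_module_hom R N M (inv_into (carrier M) f)"
proof -
  let ?g = "inv_into (carrier M) f"
  have inj: "inj_on f (carrier M)" and im: "f ` carrier M = carrier N"
    using bij by (auto simp: bij_betw_def)
  have g: "?g y \<in> carrier M" "f (?g y) = y" if "y \<in> carrier N" for y
    using that unfolding im[symmetric] by (rule inv_into_into, rule f_inv_into_f)
  have "?g (x \<oplus>\<^bsub>N\<^esub> y) = ?g x \<oplus>\<^bsub>M\<^esub> ?g y" if "x \<in> carrier N" "y \<in> carrier N" for x y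
    using that g by (intro inv_into_f_eq inj) (auto simp: add)
  moreover have "?g (r \<odot>\<^bsub>N\<^esub> x) = r \<odot>\<^bsub>M\<^esub> ?g x" if "r \<in> carrier R" "x \<in> carrier N" for r x
    using that g by (intro inv_into_f_eq inj) (auto simp: smult)
  ultimately show ?thesis
    by (intro left_module_hom.intro left_module_hom_axioms.intro M.left_module_axioms N.left_module_axioms)
       (auto simp: g)
qed

text \<open>Injectivity keeps a strict chain of submodules strict after taking images, so every
  chain length attained in \<open>M\<close> is attained in \<open>N\<close>.\<close>

lemma module_length_le:
  assumes "inj_on f (carrier M)"
  shows "module_length R M \<le> module_length R N"
  unfolding module_length_def
proof (rule Sup_subset_mono, clarsimp)
  fix k C assume C: "\<forall>i\<le>k. C i \<in> Sub R M" "\<forall>i<k. C i \<subset> C (Suc i)"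
  have "f ` C i \<subset> f ` C (Suc i)" if "i < k" for i
  proof -
    have "C i \<subset> C (Suc i)" using C that by simp
    moreover have "C (Suc i) \<subseteq> carrier M" using C that by (simp add: M.Sub_iff)
    ultimately show ?thesis
      using inj_on_image_eq_iff[OF assms, of "C i" "C (Suc i)"] by blast
  qed
  then show "\<exists>N'. (\<forall>i\<le>k. N' i \<in> Sub R N) \<and> (\<forall>i<k. N' i \<subset> N' (Suc i))"
    using C(1) image_Sub by (intro exI[of _ "\<lambda>i. f ` C i"]) auto
qed

end

lemma module_length_iso:
  assumes "left_module_hom R M N f" "bij_betw f (carrier M) (carrier N)"
  shows "module_length R M = module_length R N"
proof (rule antisym)
  interpret left_module_hom R M N f by fact
  interpret g: left_module_hom R N M "inv_into (carrier M) f" by (rule inv_hom[OF assms(2)])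
  show "module_length R M \<le> module_length R N"
    by (rule module_length_le) (use assms(2) in \<open>auto simp: bij_betw_def\<close>)
  show "module_length R N \<le> module_length R M"
    by (rule g.module_length_le) (use assms(2) in \<open>auto simp: bij_betw_def inj_on_inv_into\<close>)
qed

text \<open>A linear combination of \<open>A\<close> is carried to one of the image of
  \<open>A\<close> with corresponding coefficients. Applied to an isomorphism and to its inverse,
  this compares the generating sets in \<open>dim_iso\<close>.\<close>

lemma (in left_module_hom) gen_set_image:
  assumes "Module.module R M" "Module.module R N" "inj_on f (carrier M)" "f ` carrier M = carrier N"
    and A: "finite A" "A \<subseteq> carrier M" "LinearCombinations.module.span R M A = carrier M"
  shows "LinearCombinations.module.span R N (f ` A) = carrier N"
proof -
  interpret M': Module.module R M by fact
  interpret N': Module.module R N by fact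
  have fA: "finite (f ` A)" "f ` A \<subseteq> carrier N" using A by auto
  have inj: "inj_on f A" using assms(3) A(2) by (rule inj_on_subset)
  have "carrier N \<subseteq> N'.span (f ` A)"
  proof
    fix y assume "y \<in> carrier N"
    then obtain x where x: "x \<in> carrier M" "y = f x" using assms(4) by blast
    then have "x \<in> M'.span A" by (simp only: A(3))
    then obtain c where c: "c \<in> A \<rightarrow> carrier R" "x = M'.lincomb c A"
      unfolding M'.finite_span[OF A(1,2)] by blast
    have fin: "(\<lambda>v. c v \<odot>\<^bsub>M\<^esub> v) \<in> A \<rightarrow> carrier M" using c A by auto
    \<comment> \<open>The coefficient at \<open>f v\<close> is the one at \<open>v\<close>.
      Injectivity of \<open>f\<close> on \<open>A\<close> gives \<open>?c (f v) = c v\<close> and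
      lets the sum be reindexed over the image.\<close>
    let ?c = "\<lambda>w. c (inv_into A f w)"
    have "f x = (\<Oplus>\<^bsub>N\<^esub>v\<in>A. f (c v \<odot>\<^bsub>M\<^esub> v))"
      using c(2) fin by (simp add: M'.lincomb_def finsum)
    also have "\<dots> = (\<Oplus>\<^bsub>N\<^esub>v\<in>A. ?c (f v) \<odot>\<^bsub>N\<^esub> f v)"
      using c A inj by (intro N.finsum_cong') (auto simp: smult subset_iff Pi_iff)
    also have "\<dots> = (\<Oplus>\<^bsub>N\<^esub>w\<in>f ` A. ?c w \<odot>\<^bsub>N\<^esub> w)"
      using c A inj by (subst N.finsum_reindex) (auto simp: subset_iff Pi_iff)
    finally have "y = N'.lincomb ?c (f ` A)" unfolding N'.lincomb_def x(2) .
    moreover have "?c \<in> f ` A \<rightarrow> carrier R" using c(1) inv_into_into[of _ f A] by blast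
    ultimately show "y \<in> N'.span (f ` A)" unfolding N'.finite_span[OF fA] by blast
  qed
  moreover have "N'.span (f ` A) \<subseteq> carrier N" using fA(2) by (rule N'.span_is_subset2)
  ultimately show ?thesis by blast
qed

text \<open>\<open>dim\<close> is the least cardinality of a finite generating set, so it suffices
  that both spaces have finite generating sets of the same sizes.\<close>

lemma dim_iso:
  assumes "field K" "left_module_hom K V W f" "bij_betw f (carrier V) (carrier W)"
  shows "vectorspace.dim K V = vectorspace.dim K W"
proof -
  interpret left_module_hom K V W f by fact
  let ?g = "inv_into (carrier V) f"
  interpret g: left_module_hom K W V ?g by (rule inv_hom[OF assms(3)])
  interpret V: vectorspace K V by (rule M.vectorspaceI[OF assms(1)])
  interpret W: vectorspace K W by (rule N.vectorspaceI[OF assms(1)])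
  have f: "inj_on f (carrier V)" "f ` carrier V = carrier W"
    and g: "inj_on ?g (carrier W)" "?g ` carrier W = carrier V"
    using assms(3) bij_betw_inv_into[OF assms(3)] by (auto simp: bij_betw_def)
  have "(\<exists>A. finite A \<and> card A = n \<and> A \<subseteq> carrier V \<and> V.gen_set A) \<longleftrightarrow>
        (\<exists>A. finite A \<and> card A = n \<and> A \<subseteq> carrier W \<and> W.gen_set A)" for n
  proof
    assume "\<exists>A. finite A \<and> card A = n \<and> A \<subseteq> carrier V \<and> V.gen_set A"
    then obtain A where A: "finite A" "card A = n" "A \<subseteq> carrier V" "V.gen_set A" by blast
    then show "\<exists>A. finite A \<and> card A = n \<and> A \<subseteq> carrier W \<and> W.gen_set A"
      using gen_set_image[OF V.module_axioms W.module_axioms f A(1,3,4)] card_image[OF inj_on_subset[OF f(1) A(3)]]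
      by (intro exI[of _ "f ` A"]) auto
  next
    assume "\<exists>A. finite A \<and> card A = n \<and> A \<subseteq> carrier W \<and> W.gen_set A"
    then obtain A where A: "finite A" "card A = n" "A \<subseteq> carrier W" "W.gen_set A" by blast
    then show "\<exists>A. finite A \<and> card A = n \<and> A \<subseteq> carrier V \<and> V.gen_set A"
      using g.gen_set_image[OF W.module_axioms V.module_axioms g A(1,3,4)] card_image[OF inj_on_subset[OF g(1) A(3)]]
      by (intro exI[of _ "?g ` A"]) auto
  qed
  then show ?thesis by (simp add: V.dim_def W.dim_def)
qed

text \<open>The empty set generates the zero space. This later excludes a zero vector as generator
  of a line.\<close>

lemma (in vectorspace) dim_zero_space:
  assumes "carrier V = {\<zero>\<^bsub>V\<^esub>}"
  shows "dim = 0"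
proof -
  have "gen_set {}" using assms span_empty by metis
  then have "\<exists>A. finite A \<and> card A = 0 \<and> A \<subseteq> carrier V \<and> gen_set A"
    by (metis finite.emptyI card.empty empty_subsetI)
  then show ?thesis unfolding dim_def by (rule Least_eq_0)
qed

section \<open>Submodules of semisimple modules\<close>

lemma set_addI: "a \<in> A \<Longrightarrow> b \<in> B \<Longrightarrow> a \<oplus>\<^bsub>G\<^esub> b \<in> A <+>\<^bsub>G\<^esub> B"
  unfolding set_add_def' by blast

lemma set_addE:
  assumes "x \<in> A <+>\<^bsub>G\<^esub> B"
  obtains a b where "a \<in> A" "b \<in> B" "x = a \<oplus>\<^bsub>G\<^esub> b"
  using assms unfolding set_add_def' by blast

context left_module
begin

lemma set_add_Sub:
  assumes "A \<in> Sub R M" "B \<in> Sub R M"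
  shows "A <+>\<^bsub>M\<^esub> B \<in> Sub R M"
proof -
  have A: "A \<subseteq> carrier M" "\<zero>\<^bsub>M\<^esub> \<in> A" "\<And>x y. x \<in> A \<Longrightarrow> y \<in> A \<Longrightarrow> x \<oplus>\<^bsub>M\<^esub> y \<in> A"
    "\<And>r x. r \<in> carrier R \<Longrightarrow> x \<in> A \<Longrightarrow> r \<odot>\<^bsub>M\<^esub> x \<in> A"
    using assms(1) by (auto simp: Sub_iff)
  have B: "B \<subseteq> carrier M" "\<zero>\<^bsub>M\<^esub> \<in> B" "\<And>x y. x \<in> B \<Longrightarrow> y \<in> B \<Longrightarrow> x \<oplus>\<^bsub>M\<^esub> y \<in> B"
    "\<And>r x. r \<in> carrier R \<Longrightarrow> x \<in> B \<Longrightarrow> r \<odot>\<^bsub>M\<^esub> x \<in> B"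
    using assms(2) by (auto simp: Sub_iff)
  have "(a \<oplus>\<^bsub>M\<^esub> b) \<oplus>\<^bsub>M\<^esub> (a' \<oplus>\<^bsub>M\<^esub> b') \<in> A <+>\<^bsub>M\<^esub> B"
    if "a \<in> A" "b \<in> B" "a' \<in> A" "b' \<in> B" for a b a' b'
  proof -
    have "a \<in> carrier M" "b \<in> carrier M" "a' \<in> carrier M" "b' \<in> carrier M"
      using that A(1) B(1) by auto
    then have "(a \<oplus>\<^bsub>M\<^esub> b) \<oplus>\<^bsub>M\<^esub> (a' \<oplus>\<^bsub>M\<^esub> b') = (a \<oplus>\<^bsub>M\<^esub> a') \<oplus>\<^bsub>M\<^esub> (b \<oplus>\<^bsub>M\<^esub> b')"
      by (simp add: M.a_ac)
    then show ?thesis using that A(3) B(3) by (simp add: set_addI)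
  qed
  moreover have "r \<odot>\<^bsub>M\<^esub> (a \<oplus>\<^bsub>M\<^esub> b) \<in> A <+>\<^bsub>M\<^esub> B" if "a \<in> A" "b \<in> B" "r \<in> carrier R" for r a b
  proof -
    have "r \<odot>\<^bsub>M\<^esub> (a \<oplus>\<^bsub>M\<^esub> b) = (r \<odot>\<^bsub>M\<^esub> a) \<oplus>\<^bsub>M\<^esub> (r \<odot>\<^bsub>M\<^esub> b)"
      using that A(1) B(1) by (simp add: smult_r_distr subset_iff)
    then show ?thesis using that A(4) B(4) by (simp add: set_addI)
  qed
  moreover have "\<zero>\<^bsub>M\<^esub> \<in> A <+>\<^bsub>M\<^esub> B"
    using set_addI[OF A(2) B(2), of M] by simp
  moreover have "A <+>\<^bsub>M\<^esub> B \<subseteq> carrier M" using A(1) B(1) unfolding set_add_def' by auto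
  ultimately show ?thesis unfolding Sub_iff by (blast elim!: set_addE)
qed

lemma set_add_upper:
  assumes "A \<in> Sub R M" "B \<in> Sub R M"
  shows "A \<subseteq> A <+>\<^bsub>M\<^esub> B" "B \<subseteq> A <+>\<^bsub>M\<^esub> B"
proof -
  have AB: "A \<subseteq> carrier M" "\<zero>\<^bsub>M\<^esub> \<in> A" "B \<subseteq> carrier M" "\<zero>\<^bsub>M\<^esub> \<in> B"
    using assms by (auto simp: Sub_iff)
  show "A \<subseteq> A <+>\<^bsub>M\<^esub> B"
  proof
    fix x assume "x \<in> A"
    moreover from this have "x = x \<oplus>\<^bsub>M\<^esub> \<zero>\<^bsub>M\<^esub>" using AB(1) by auto
    ultimately show "x \<in> A <+>\<^bsub>M\<^esub> B" using AB(4) set_addI by metis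
  qed
  show "B \<subseteq> A <+>\<^bsub>M\<^esub> B"
  proof
    fix x assume "x \<in> B"
    moreover from this have "x = \<zero>\<^bsub>M\<^esub> \<oplus>\<^bsub>M\<^esub> x" using AB(3) by auto
    ultimately show "x \<in> A <+>\<^bsub>M\<^esub> B" using AB(2) set_addI by metis
  qed
qed

text \<open>Rearranging the two decompositions gives -a' + a = b' - b, an element of both
  \<open>A\<close> and \<open>B\<close>, hence zero.\<close>

lemma direct_sum_unique:
  assumes AB: "A \<in> Sub R M" "B \<in> Sub R M" "A \<inter> B = {\<zero>\<^bsub>M\<^esub>}"
    and ab: "a \<in> A" "a' \<in> A" "b \<in> B" "b' \<in> B" and eq: "a \<oplus>\<^bsub>M\<^esub> b = a' \<oplus>\<^bsub>M\<^esub> b'"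
  shows "a = a'" "b = b'"
proof -
  have cl [simp]: "a \<in> carrier M" "a' \<in> carrier M" "b \<in> carrier M" "b' \<in> carrier M"
    using AB ab by (auto simp: Sub_iff)
  have "\<ominus>\<^bsub>M\<^esub> a' \<oplus>\<^bsub>M\<^esub> (a \<oplus>\<^bsub>M\<^esub> b) \<oplus>\<^bsub>M\<^esub> \<ominus>\<^bsub>M\<^esub> b = \<ominus>\<^bsub>M\<^esub> a' \<oplus>\<^bsub>M\<^esub> a"
    by (simp add: M.a_assoc M.r_neg)
  moreover have "\<ominus>\<^bsub>M\<^esub> a' \<oplus>\<^bsub>M\<^esub> (a' \<oplus>\<^bsub>M\<^esub> b') \<oplus>\<^bsub>M\<^esub> \<ominus>\<^bsub>M\<^esub> b = b' \<oplus>\<^bsub>M\<^esub> \<ominus>\<^bsub>M\<^esub> b"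
    by (simp add: M.r_neg1)
  ultimately have "\<ominus>\<^bsub>M\<^esub> a' \<oplus>\<^bsub>M\<^esub> a = b' \<oplus>\<^bsub>M\<^esub> \<ominus>\<^bsub>M\<^esub> b" using eq by simp
  moreover have "\<ominus>\<^bsub>M\<^esub> a' \<oplus>\<^bsub>M\<^esub> a \<in> A" "b' \<oplus>\<^bsub>M\<^esub> \<ominus>\<^bsub>M\<^esub> b \<in> B"
    using AB(1,2) ab Sub_minus[OF AB(1) ab(2)] Sub_minus[OF AB(2) ab(3)] by (simp_all add: Sub_iff)
  ultimately have "\<ominus>\<^bsub>M\<^esub> a' \<oplus>\<^bsub>M\<^esub> a = \<zero>\<^bsub>M\<^esub>" using AB(3) by auto
  then show "a = a'" using M.r_neg2[of a' a] by simp
  with eq show "b = b'" by simp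
qed

lemma simple_restrict_iff:
  assumes "S \<in> Sub R M"
  shows "simple_module R (M\<lparr>carrier := S\<rparr>) \<longleftrightarrow>
    S \<noteq> {\<zero>\<^bsub>M\<^esub>} \<and> (\<forall>B\<in>Sub R M. B \<subseteq> S \<longrightarrow> B = {\<zero>\<^bsub>M\<^esub>} \<or> B = S)"
proof -
  have "{\<zero>\<^bsub>M\<^esub>} \<subseteq> S" using assms by (simp add: Sub_iff)
  then have "{B \<in> Sub R M. B \<subseteq> S} = {{\<zero>\<^bsub>M\<^esub>}, S} \<longleftrightarrow>
      (\<forall>B\<in>Sub R M. B \<subseteq> S \<longrightarrow> B = {\<zero>\<^bsub>M\<^esub>} \<or> B = S)"
    using assms zero_Sub by auto
  then show ?thesis unfolding simple_module_def Sub_restrict[OF assms] by simp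
qed

text \<open>The intersection is a submodule of the simple module \<open>S\<close>, and it is not all
  of \<open>S\<close>.\<close>

lemma simple_disjoint:
  assumes "S \<in> Sub R M" "simple_module R (M\<lparr>carrier := S\<rparr>)" "A \<in> Sub R M" "\<not> S \<subseteq> A"
  shows "S \<inter> A = {\<zero>\<^bsub>M\<^esub>}"
  using assms(2) Int_Sub[OF assms(1,3)] assms(4) unfolding simple_restrict_iff[OF assms(1)] by blast

end

text \<open>Semisimplicity in lattice form: every submodule is a direct summand. Unlike a chosen
  decomposition into simple modules, this form passes easily to submodules.\<close>

definition complemented :: "('r, 'p) ring_scheme \<Rightarrow> ('r, 'm, 'q) module_scheme \<Rightarrow> bool" where
  "complemented R M \<longleftrightarrow>
     (\<forall>N\<in>Sub R M. \<exists>B\<in>Sub R M. N \<inter> B = {\<zero>\<^bsub>M\<^esub>} \<and> N <+>\<^bsub>M\<^esub> B = carrier M)"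

context left_module
begin

text \<open>
  A complement of \<open>N\<close> is a submodule that meets \<open>N\<close> trivially and contains as many of the
  generating simple submodules as possible.
\<close>

lemma complemented_if_simple_generated:
  assumes fin: "finite \<S>"
    and simple: "\<And>S. S \<in> \<S> \<Longrightarrow> S \<in> Sub R M \<and> simple_module R (M\<lparr>carrier := S\<rparr>)"
    and gen: "\<And>T. T \<in> Sub R M \<Longrightarrow> (\<And>S. S \<in> \<S> \<Longrightarrow> S \<subseteq> T) \<Longrightarrow> T = carrier M"
  shows "complemented R M"
  unfolding complemented_def
proof
  fix N assume N: "N \<in> Sub R M"
  define P where "P B \<longleftrightarrow> B \<in> Sub R M \<and> N \<inter> B = {\<zero>\<^bsub>M\<^esub>}" for B
  define h where "h B = card {S \<in> \<S>. S \<subseteq> B}" for B :: "'m set"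
  have "P {\<zero>\<^bsub>M\<^esub>}" using N zero_Sub by (auto simp: P_def Sub_iff)
  moreover have "h B \<le> card \<S>" for B unfolding h_def using fin by (auto intro: card_mono)
  ultimately have "\<exists>B. P B \<and> (\<forall>B'. P B' \<longrightarrow> h B' \<le> h B)"
    by (intro ex_has_greatest_nat[of P "{\<zero>\<^bsub>M\<^esub>}" h "Suc (card \<S>)"]) (auto simp: less_Suc_eq_le)
  then obtain B where B: "P B" and max: "\<And>B'. P B' \<Longrightarrow> h B' \<le> h B"
    by blast
  have B_Sub: "B \<in> Sub R M" and disj: "N \<inter> B = {\<zero>\<^bsub>M\<^esub>}" using B by (auto simp: P_def)
  \<comment> \<open>By \<open>gen\<close> it suffices that \<open>N + B\<close> contains every
    generating \<open>S\<close>. If some \<open>S\<close> were not contained in it, then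
    \<open>S\<close> would meet \<open>N + B\<close> trivially, \<open>B + S\<close> would still
    meet \<open>N\<close> trivially, and \<open>B + S\<close> would contain one more generator than
    the maximal \<open>B\<close>.\<close>
  have "N <+>\<^bsub>M\<^esub> B = carrier M"
  proof (rule gen)
    show NB: "N <+>\<^bsub>M\<^esub> B \<in> Sub R M" using N B_Sub by (rule set_add_Sub)
    fix S assume S: "S \<in> \<S>"
    then have S_Sub: "S \<in> Sub R M" using simple by blast
    show "S \<subseteq> N <+>\<^bsub>M\<^esub> B"
    proof (rule ccontr)
      assume nsub: "\<not> S \<subseteq> N <+>\<^bsub>M\<^esub> B"
      then have S0: "S \<inter> (N <+>\<^bsub>M\<^esub> B) = {\<zero>\<^bsub>M\<^esub>}"
        using simple_disjoint S_Sub simple[OF S] NB by blast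
      have BS: "B <+>\<^bsub>M\<^esub> S \<in> Sub R M" using B_Sub S_Sub by (rule set_add_Sub)
      have "x = \<zero>\<^bsub>M\<^esub>" if x: "x \<in> N" "x \<in> B <+>\<^bsub>M\<^esub> S" for x
      proof -
        obtain b s where bs: "b \<in> B" "s \<in> S" "x = b \<oplus>\<^bsub>M\<^esub> s"
          using x(2) by (rule set_addE)
        have cl: "b \<in> carrier M" "s \<in> carrier M" "x \<in> carrier M"
          using bs B_Sub S_Sub N x(1) by (auto simp: Sub_iff)
        have "\<ominus>\<^bsub>M\<^esub> b \<oplus>\<^bsub>M\<^esub> x = s" using cl by (simp add: bs(3) M.r_neg1)
        then have "x \<oplus>\<^bsub>M\<^esub> \<ominus>\<^bsub>M\<^esub> b = s" using cl M.a_comm[of x "\<ominus>\<^bsub>M\<^esub> b"] by simp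
        \<comment> \<open>Written as x - b, the element \<open>s\<close> of \<open>S\<close> lies in
          \<open>N + B\<close>, so it vanishes, and x = b lies in both \<open>N\<close> and
          \<open>B\<close>.\<close>
        then have "s \<in> N <+>\<^bsub>M\<^esub> B" using set_addI[OF x(1) Sub_minus[OF B_Sub bs(1)], of M] by simp
        then have "s = \<zero>\<^bsub>M\<^esub>" using S0 bs(2) by blast
        then have "x = b" using bs cl by simp
        then show ?thesis using disj bs(1) x(1) by blast
      qed
      then have "P (B <+>\<^bsub>M\<^esub> S)" using BS N by (auto simp: P_def Sub_iff)
      moreover have "h B < h (B <+>\<^bsub>M\<^esub> S)"
        unfolding h_def
      proof (rule psubset_card_mono)
        have "S \<subseteq> B <+>\<^bsub>M\<^esub> S" "B \<subseteq> B <+>\<^bsub>M\<^esub> S" using set_add_upper[OF B_Sub S_Sub] by auto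
        moreover have "\<not> S \<subseteq> B" using set_add_upper(2)[OF N B_Sub] nsub by auto
        ultimately show "{S' \<in> \<S>. S' \<subseteq> B} \<subset> {S' \<in> \<S>. S' \<subseteq> B <+>\<^bsub>M\<^esub> S}"
          using S by auto
      qed (use fin in auto)
      ultimately show False using max[of "B <+>\<^bsub>M\<^esub> S"] by simp
    qed
  qed
  then show "\<exists>B\<in>Sub R M. N \<inter> B = {\<zero>\<^bsub>M\<^esub>} \<and> N <+>\<^bsub>M\<^esub> B = carrier M"
    using B_Sub disj by blast
qed

text \<open>The modular law: if \<open>B\<close> is a complement of \<open>N\<close> in
  \<open>M\<close> and \<open>N\<close> lies in \<open>Q\<close>, then the intersection of
  \<open>B\<close> and \<open>Q\<close> is a complement of \<open>N\<close> in
  \<open>Q\<close>.\<close>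

lemma complemented_restrict:
  assumes "complemented R M" and Q: "Q \<in> Sub R M"
  shows "complemented R (M\<lparr>carrier := Q\<rparr>)"
  unfolding complemented_def Sub_restrict[OF Q]
proof
  fix N assume "N \<in> {B \<in> Sub R M. B \<subseteq> Q}"
  then have N: "N \<in> Sub R M" "N \<subseteq> Q" by auto
  obtain B where B: "B \<in> Sub R M" "N \<inter> B = {\<zero>\<^bsub>M\<^esub>}" "N <+>\<^bsub>M\<^esub> B = carrier M"
    using assms(1) N(1) unfolding complemented_def by blast
  have "x \<in> N <+>\<^bsub>M\<^esub> (B \<inter> Q)" if x: "x \<in> Q" for x
  proof -
    have "x \<in> N <+>\<^bsub>M\<^esub> B" using x Q B(3) by (auto simp: Sub_iff)
    then obtain n b where nb: "n \<in> N" "b \<in> B" "x = n \<oplus>\<^bsub>M\<^esub> b"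
      by (rule set_addE)
    have cl: "n \<in> carrier M" "b \<in> carrier M" using nb N B by (auto simp: Sub_iff)
    have "b = \<ominus>\<^bsub>M\<^esub> n \<oplus>\<^bsub>M\<^esub> x" using cl nb(3) by (simp add: M.r_neg1)
    moreover have "\<ominus>\<^bsub>M\<^esub> n \<in> Q" using Sub_minus[OF Q] nb(1) N(2) by blast
    ultimately have "b \<in> Q" using x Q by (simp add: Sub_iff)
    then show ?thesis using nb by (simp add: set_addI)
  qed
  moreover have "N <+>\<^bsub>M\<^esub> (B \<inter> Q) \<subseteq> Q" using N(2) Q unfolding set_add_def' by (auto simp: Sub_iff)
  ultimately have "N <+>\<^bsub>M\<^esub> (B \<inter> Q) = Q" by blast
  moreover have "N \<inter> (B \<inter> Q) = {\<zero>\<^bsub>M\<^esub>}" using B(2) N(2) by blast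
  ultimately show "\<exists>B\<in>{B \<in> Sub R M. B \<subseteq> Q}. N \<inter> B = {\<zero>\<^bsub>M\<lparr>carrier := Q\<rparr>\<^esub>} \<and>
      N <+>\<^bsub>M\<lparr>carrier := Q\<rparr>\<^esub> B = carrier (M\<lparr>carrier := Q\<rparr>)"
    using Int_Sub[OF B(1) Q] by (intro bexI[of _ "B \<inter> Q"]) (auto simp: set_add_def')
qed

text \<open>An infinite descending chain, cut off after \<open>Suc d\<close> steps and read
  backwards, would be a strictly increasing chain longer than the length allows.\<close>

lemma wf_Sub:
  assumes "module_length R M = enat d"
  shows "wf {(A, B). A \<in> Sub R M \<and> B \<in> Sub R M \<and> A \<subset> B}"
  unfolding wf_iff_no_infinite_down_chain
proof
  assume "\<exists>f. \<forall>i. (f (Suc i), f i) \<in> {(A, B). A \<in> Sub R M \<and> B \<in> Sub R M \<and> A \<subset> B}"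
  then obtain f where "\<forall>i. (f (Suc i), f i) \<in> {(A, B). A \<in> Sub R M \<and> B \<in> Sub R M \<and> A \<subset> B}"
    by (rule exE)
  then have f: "\<And>i. f i \<in> Sub R M" "\<And>i. f (Suc i) \<subset> f i" by auto
  let ?N = "\<lambda>i. f (Suc d - i)"
  have "?N i \<subset> ?N (Suc i)" if "i < Suc d" for i
    using f(2)[of "d - i"] that by (simp add: Suc_diff_le)
  then have "\<exists>N. (\<forall>i\<le>Suc d. N i \<in> Sub R M) \<and> (\<forall>i<Suc d. N i \<subset> N (Suc i))"
    using f(1) by (intro exI[of _ ?N]) auto
  then have "enat (Suc d) \<le> module_length R M"
    unfolding module_length_def by (intro Sup_upper) blast
  with assms show False by simp
qed

text \<open>Well-founded induction on a submodule \<open>B\<close>: split off a minimal nonzero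
  submodule \<open>S\<close> of \<open>B\<close>, take a complement \<open>C\<close> of
  \<open>S\<close> in \<open>M\<close>, and decompose the strictly smaller intersection of
  \<open>C\<close> and \<open>B\<close>. Finite length supplies both the minimal submodule and the
  induction.\<close>

lemma semisimple_if_complemented:
  assumes compl: "complemented R M" and len: "module_length R M = enat d"
  shows "semisimple_module R M"
proof -
  note wf = wf_Sub[OF len]
  have "\<exists>k S. (\<forall>i<(k::nat). S i \<in> Sub R M \<and> simple_module R (M\<lparr>carrier := S i\<rparr>) \<and> S i \<subseteq> B) \<and>
          (\<forall>x\<in>B. \<exists>!s. s \<in> (\<Pi>\<^sub>E i\<in>{..<k}. S i) \<and> x = finsum M s {..<k})"
    if "B \<in> Sub R M" for B
    using wf that
  proof (induction B rule: wf_induct_rule)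
    case (less B)
    show ?case
    proof (cases "B = {\<zero>\<^bsub>M\<^esub>}")
      case True
      then show ?thesis by (intro exI[of _ 0]) auto
    next
      case False
      then have "B \<in> {A \<in> Sub R M. A \<subseteq> B \<and> A \<noteq> {\<zero>\<^bsub>M\<^esub>}}" using less.prems by auto
      then obtain S where S: "S \<in> Sub R M" "S \<subseteq> B" "S \<noteq> {\<zero>\<^bsub>M\<^esub>}"
        and min: "\<And>A. (A, S) \<in> {(A, B). A \<in> Sub R M \<and> B \<in> Sub R M \<and> A \<subset> B} \<Longrightarrow>
          A \<notin> {A \<in> Sub R M. A \<subseteq> B \<and> A \<noteq> {\<zero>\<^bsub>M\<^esub>}}"
        by (rule wfE_min[OF wf]) auto
      have simple: "simple_module R (M\<lparr>carrier := S\<rparr>)"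
        unfolding simple_restrict_iff[OF S(1)]
      proof (intro conjI ballI impI)
        fix A assume "A \<in> Sub R M" "A \<subseteq> S"
        then show "A = {\<zero>\<^bsub>M\<^esub>} \<or> A = S" using min[of A] S by blast
      qed (rule S(3))
      obtain C where C: "C \<in> Sub R M" "S \<inter> C = {\<zero>\<^bsub>M\<^esub>}" "S <+>\<^bsub>M\<^esub> C = carrier M"
        using compl S(1) unfolding complemented_def by blast
      have CB: "C \<inter> B \<in> Sub R M" using C(1) less.prems by (rule Int_Sub)
      have "C \<inter> B \<noteq> B"
      proof
        assume "C \<inter> B = B"
        then have "S \<inter> C = S" using S(2) by blast
        with C(2) S(3) show False by simp
      qed
      then have "(C \<inter> B, B) \<in> {(A, B). A \<in> Sub R M \<and> B \<in> Sub R M \<and> A \<subset> B}"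
        using CB less.prems by auto
      from less.IH[OF this CB] obtain k T where
        T: "\<forall>i<(k::nat). T i \<in> Sub R M \<and> simple_module R (M\<lparr>carrier := T i\<rparr>) \<and> T i \<subseteq> C \<inter> B"
        and dec: "\<forall>x\<in>C \<inter> B. \<exists>!s. s \<in> (\<Pi>\<^sub>E i\<in>{..<k}. T i) \<and> x = finsum M s {..<k}"
        by (elim exE conjE) (rule that)
      \<comment> \<open>The new summand \<open>S\<close> gets the last index \<open>k\<close>, so a
        sum over \<open>{..<Suc k}\<close> splits into its term at \<open>k\<close> and a sum over
        the old indices.\<close>
      define U where "U = T(k := S)"
      have U_Sub: "U i \<in> Sub R M \<and> simple_module R (M\<lparr>carrier := U i\<rparr>) \<and> U i \<subseteq> B" if "i < Suc k" for i
        using that T[rule_format, of i] S simple by (cases "i = k") (auto simp: U_def)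
      \<comment> \<open>Any family of components for \<open>B\<close> yields a summand in
        \<open>S\<close> and a family for the smaller submodule. The restriction is taken because
        members of the extensional product must be \<open>undefined\<close> off their index
        set.\<close>
      have split: "finsum M e {..<Suc k} = e k \<oplus>\<^bsub>M\<^esub> finsum M e {..<k} \<and> e k \<in> S \<and>
          finsum M e {..<k} \<in> C \<inter> B \<and> restrict e {..<k} \<in> (\<Pi>\<^sub>E i\<in>{..<k}. T i) \<and>
          finsum M e {..<k} = finsum M (restrict e {..<k}) {..<k}"
        if e: "e \<in> (\<Pi>\<^sub>E i\<in>{..<Suc k}. U i)" for e
      proof -
        have ek: "e k \<in> S" using PiE_mem[OF e, of k] by (simp add: U_def)
        have ei: "e i \<in> T i" if "i < k" for i using PiE_mem[OF e, of i] that by (simp add: U_def)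
        have eCB: "e \<in> {..<k} \<rightarrow> C \<inter> B" using ei T by blast
        have CBc: "C \<inter> B \<subseteq> carrier M" "S \<subseteq> carrier M" using CB S(1) by (simp_all add: Sub_iff)
        have eM: "e \<in> {..<k} \<rightarrow> carrier M" using eCB CBc by blast
        have "finsum M e {..<Suc k} = e k \<oplus>\<^bsub>M\<^esub> finsum M e {..<k}"
          unfolding lessThan_Suc using ek eM CBc by (intro M.finsum_insert) auto
        moreover have "finsum M e {..<k} = finsum M (restrict e {..<k}) {..<k}"
          using eM by (intro M.finsum_cong') auto
        ultimately show ?thesis using ek ei Sub_finsum[OF CB eCB] by (simp add: PiE_iff)
      qed
      have "\<exists>!s. s \<in> (\<Pi>\<^sub>E i\<in>{..<Suc k}. U i) \<and> x = finsum M s {..<Suc k}" if x: "x \<in> B" for x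
      proof -
        have "x \<in> S <+>\<^bsub>M\<^esub> C" using x less.prems C(3) by (auto simp: Sub_iff)
        then obtain s c where sc: "s \<in> S" "c \<in> C" "x = s \<oplus>\<^bsub>M\<^esub> c"
          by (rule set_addE)
        have cl: "s \<in> carrier M" "c \<in> carrier M" using sc S(1) C(1) by (auto simp: Sub_iff)
        have "c = \<ominus>\<^bsub>M\<^esub> s \<oplus>\<^bsub>M\<^esub> x" using cl sc(3) by (simp add: M.r_neg1)
        moreover have "\<ominus>\<^bsub>M\<^esub> s \<in> B" using Sub_minus[OF less.prems] sc(1) S(2) by blast
        ultimately have c: "c \<in> C \<inter> B" using x less.prems sc(2) by (simp add: Sub_iff)
        from dec[rule_format, OF c] obtain e where
          "e \<in> (\<Pi>\<^sub>E i\<in>{..<k}. T i) \<and> c = finsum M e {..<k}"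
          and uniq: "\<forall>e'. e' \<in> (\<Pi>\<^sub>E i\<in>{..<k}. T i) \<and> c = finsum M e' {..<k} \<longrightarrow> e' = e"
          by (elim ex1E) (rule that)
        then have e: "e \<in> (\<Pi>\<^sub>E i\<in>{..<k}. T i)" "c = finsum M e {..<k}" by auto
        define e1 where "e1 = e(k := s)"
        have e1: "e1 \<in> (\<Pi>\<^sub>E i\<in>{..<Suc k}. U i)"
          using e(1) sc(1) by (auto simp: e1_def U_def PiE_iff extensional_def less_Suc_eq)
        have "restrict e1 {..<k} = e"
          using e(1) by (auto simp: e1_def PiE_iff extensional_def fun_eq_iff)
        then have xe1: "x = finsum M e1 {..<Suc k}"
          using split[OF e1] e(2) sc(3) by (simp add: e1_def)
        \<comment> \<open>The sum of \<open>S\<close> and \<open>C\<close> is direct, so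
          \<open>e2 k\<close> is \<open>s\<close> and the remaining terms sum to \<open>c\<close>.
          Uniqueness for the smaller submodule fixes the indices below \<open>k\<close>, and beyond
          \<open>k\<close> both families are \<open>undefined\<close>.\<close>
        have e2_e1: "e2 = e1" if e2: "e2 \<in> (\<Pi>\<^sub>E i\<in>{..<Suc k}. U i)" "x = finsum M e2 {..<Suc k}" for e2
        proof -
          have "s \<oplus>\<^bsub>M\<^esub> c = e2 k \<oplus>\<^bsub>M\<^esub> finsum M e2 {..<k}" using split[OF e2(1)] e2(2) sc(3) by simp
          then have s: "s = e2 k" and "c = finsum M e2 {..<k}"
            using direct_sum_unique[OF S(1) C(1,2)] sc(1,2) split[OF e2(1)] by blast+
          then have r: "restrict e2 {..<k} = e" using uniq split[OF e2(1)] by simp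
          show ?thesis
          proof
            fix i
            consider "i < k" | "i = k" | "i > k" by linarith
            then show "e2 i = e1 i"
            proof cases
              case 1
              then show ?thesis using r by (auto simp: e1_def)
            next
              case 3
              then show ?thesis using PiE_arb[OF e2(1), of i] PiE_arb[OF e1, of i] by simp
            qed (simp add: e1_def s)
          qed
        qed
        show ?thesis by (rule ex1I, rule conjI[OF e1 xe1], elim conjE, rule e2_e1)
      qed
      then show ?thesis
        by (intro exI[of _ "Suc k"] exI[of _ U] conjI[OF allI[OF impI[OF U_Sub]] ballI])
    qed
  qed
  from this[OF carrier_Sub] obtain k S where
    S: "\<forall>i<(k::nat). S i \<in> Sub R M \<and> simple_module R (M\<lparr>carrier := S i\<rparr>) \<and> S i \<subseteq> carrier M"
    and dec: "\<forall>x\<in>carrier M. \<exists>!s. s \<in> (\<Pi>\<^sub>E i\<in>{..<k}. S i) \<and> x = finsum M s {..<k}"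
    by (elim exE conjE) (rule that)
  have "\<forall>i<k. S i \<in> Sub R M \<and> simple_module R (M\<lparr>carrier := S i\<rparr>)" using S by simp
  then show ?thesis
    unfolding semisimple_module_def by (intro exI[of _ k] exI[of _ S] conjI[OF _ dec])
qed

end

text \<open>A submodule of the image of \<open>S\<close> is the image of its preimage in
  \<open>S\<close>, and simplicity leaves only zero or \<open>S\<close> for that preimage.\<close>

lemma (in left_module_hom) simple_image:
  assumes inj: "inj_on f (carrier M)" and S: "S \<in> Sub R M" "simple_module R (M\<lparr>carrier := S\<rparr>)"
  shows "simple_module R (N\<lparr>carrier := f ` S\<rparr>)"
  unfolding N.simple_restrict_iff[OF image_Sub[OF S(1)]]
proof (intro conjI ballI impI)
  have S': "S \<subseteq> carrier M" "S \<noteq> {\<zero>\<^bsub>M\<^esub>}"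
    using S by (auto simp: M.Sub_iff M.simple_restrict_iff)
  show "f ` S \<noteq> {\<zero>\<^bsub>N\<^esub>}"
    using S' inj_on_image_eq_iff[OF inj, of S "{\<zero>\<^bsub>M\<^esub>}"] by auto
  fix B assume B: "B \<in> Sub R N" "B \<subseteq> f ` S"
  let ?A = "{x \<in> carrier M. f x \<in> B} \<inter> S"
  have "?A \<in> Sub R M" using vimage_Sub[OF B(1)] S(1) by (rule M.Int_Sub)
  then have "?A = {\<zero>\<^bsub>M\<^esub>} \<or> ?A = S" using S by (simp add: M.simple_restrict_iff)
  moreover have "B = f ` ?A" using B(2) S'(1) by auto
  ultimately show "B = {\<zero>\<^bsub>N\<^esub>} \<or> B = f ` S" by force
qed

lemma (in left_module) embedding_hom:
  assumes "j < n"
  shows "left_module_hom R M (power_module M n) (\<lambda>x. (replicate n \<zero>\<^bsub>M\<^esub>)[j := x])"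
proof (intro left_module_hom.intro left_module_hom_axioms.intro left_module_axioms left_module_power)
  fix x assume "x \<in> carrier M"
  then show "(replicate n \<zero>\<^bsub>M\<^esub>)[j := x] \<in> carrier (power_module M n)"
    using set_update_subset_insert[of "replicate n \<zero>\<^bsub>M\<^esub>" j x]
    by (auto simp: set_replicate_conv_if split: if_splits)
qed (use assms in \<open>auto intro!: nth_equalityI simp: nth_list_update\<close>)

text \<open>The power is generated by finitely many simple submodules: the copies of the simple
  summands of \<open>M\<close> in each of the \<open>n\<close> coordinates.\<close>

lemma (in left_module) complemented_power:
  assumes "semisimple_module R M"
  shows "complemented R (power_module M n)"
proof -
  let ?P = "power_module M n"
  interpret P: left_module R ?P by (rule left_module_power)
  obtain k S where S: "\<forall>i<(k::nat). S i \<in> Sub R M \<and> simple_module R (M\<lparr>carrier := S i\<rparr>)"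
    and dec1: "\<forall>x\<in>carrier M. \<exists>!s. s \<in> (\<Pi>\<^sub>E i\<in>{..<k}. S i) \<and> x = finsum M s {..<k}"
    using assms unfolding semisimple_module_def by (elim exE conjE) (rule that)
  note S = S[rule_format] and dec = ex1_implies_ex[OF dec1[rule_format]]
  define emb where "emb j x = (replicate n \<zero>\<^bsub>M\<^esub>)[j := x]" for j x
  have emb: "left_module_hom R M ?P (emb j)" if "j < n" for j
    using embedding_hom[OF that] unfolding emb_def .
  have inj: "inj_on (emb j) (carrier M)" if "j < n" for j
  proof (rule inj_onI)
    fix x y assume "emb j x = emb j y"
    then have "emb j x ! j = emb j y ! j" by simp
    then show "x = y" using that by (simp add: emb_def)
  qed
  let ?\<S> = "(\<lambda>(i, j). emb j ` S i) ` ({..<k} \<times> {..<n})"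
  show ?thesis
  proof (rule P.complemented_if_simple_generated[of ?\<S>])
    fix A assume "A \<in> ?\<S>"
    then obtain i j where ij: "i < k" "j < n" "A = emb j ` S i" by auto
    interpret left_module_hom R M ?P "emb j" by (rule emb[OF ij(2)])
    show "A \<in> Sub R ?P \<and> simple_module R (?P\<lparr>carrier := A\<rparr>)"
      using S[OF ij(1)] image_Sub simple_image[OF inj[OF ij(2)]] ij(3) by blast
  next
    fix T assume T: "T \<in> Sub R ?P" and sub: "\<And>A. A \<in> ?\<S> \<Longrightarrow> A \<subseteq> T"
    have T': "\<zero>\<^bsub>?P\<^esub> \<in> T" "\<And>x y. x \<in> T \<Longrightarrow> y \<in> T \<Longrightarrow> x \<oplus>\<^bsub>?P\<^esub> y \<in> T" "T \<subseteq> carrier ?P"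
      using T unfolding P.Sub_iff by blast+
    have emb_T: "emb j x \<in> T" if j: "j < n" and x: "x \<in> carrier M" for j x
    proof -
      interpret left_module_hom R M ?P "emb j" by (rule emb[OF j])
      \<comment> \<open>The vectors whose j-th copy lies in \<open>T\<close> form a submodule of
        \<open>M\<close> containing every simple summand \<open>S i\<close>, hence all sums of their
        elements.\<close>
      let ?X = "{x \<in> carrier M. emb j x \<in> T}"
      have X: "?X \<in> Sub R M" using T by (rule vimage_Sub)
      obtain s where s: "s \<in> (\<Pi>\<^sub>E i\<in>{..<k}. S i)" "x = finsum M s {..<k}" using dec[OF x] by blast
      have "S i \<subseteq> ?X" if "i < k" for i
      proof -
        have "S i \<subseteq> carrier M" using S[OF that] by (simp add: Sub_iff)
        moreover have "emb j ` S i \<subseteq> T" using that j by (intro sub) auto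
        ultimately show ?thesis by blast
      qed
      then have "s \<in> {..<k} \<rightarrow> ?X" using s(1) by blast
      then have "finsum M s {..<k} \<in> ?X" by (rule Sub_finsum[OF X])
      then show ?thesis using s(2) by simp
    qed
    have len_emb: "length (emb j x) = n" for j x
      by (simp add: emb_def)
    have nth_emb: "emb j x ! i = (if i = j then x else \<zero>\<^bsub>M\<^esub>)" if "j < n" "i < n" for i j x
      using that by (simp add: emb_def nth_list_update)
    have "xs \<in> T" if xs: "xs \<in> carrier ?P" for xs
    proof -
      have len: "length xs = n" and nth: "xs ! i \<in> carrier M" if "i < n" for i
        using xs that by auto
      \<comment> \<open>The vector \<open>xs\<close> is built up from zero by adding one embedded
        coordinate at a time.\<close>
      have "take t xs @ replicate (n - t) \<zero>\<^bsub>M\<^esub> \<in> T" if "t \<le> n" for t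
        using that
      proof (induction t)
        case 0
        then show ?case using T'(1) by simp
      next
        case (Suc t)
        have "take (Suc t) xs @ replicate (n - Suc t) \<zero>\<^bsub>M\<^esub> =
            (take t xs @ replicate (n - t) \<zero>\<^bsub>M\<^esub>) \<oplus>\<^bsub>?P\<^esub> emb t (xs ! t)"
          using Suc.prems xs
          by (intro nth_equalityI) (auto simp: len_emb nth_emb nth_append nth less_Suc_eq min_def)
        then show ?case using Suc T'(2) emb_T[of t "xs ! t"] nth[of t] by simp
      qed
      from this[of n] show ?thesis using xs by simp
    qed
    then show "T = carrier ?P" using T'(3) by blast
  qed simp
qed

text \<open>Complements exist in the power and hence in \<open>N\<close>. The finite length of
  \<open>N\<close> then turns them back into a decomposition into simple modules. This is what makes
  \<open>M'\<close> semisimple.\<close>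

lemma (in left_module) semisimple_Sub_power:
  assumes "semisimple_module R M" "N \<in> Sub R (power_module M n)"
    and "module_length R ((power_module M n)\<lparr>carrier := N\<rparr>) = enat d"
  shows "semisimple_module R ((power_module M n)\<lparr>carrier := N\<rparr>)"
proof -
  interpret P: left_module R "power_module M n" by (rule left_module_power)
  interpret N: left_module R "(power_module M n)\<lparr>carrier := N\<rparr>"
    by (rule P.left_module_restrict[OF assms(2)])
  show ?thesis
    using N.semisimple_if_complemented P.complemented_restrict complemented_power assms by blast
qed

section \<open>Powers of modules\<close>

lemma left_module_hom_comp:
  assumes "left_module_hom R M N f" "left_module_hom R N P g"
  shows "left_module_hom R M P (\<lambda>x. g (f x))"
proof -
  interpret f: left_module_hom R M N f by fact
  interpret g: left_module_hom R N P g by fact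
  show ?thesis
    by (intro left_module_hom.intro left_module_hom_axioms.intro f.M.left_module_axioms g.N.left_module_axioms)
       (simp_all add: f.add f.smult g.add g.smult)
qed

lemma (in left_module_hom) map_hom:
  "left_module_hom R (power_module M n) (power_module N n) (map f)"
proof (intro left_module_hom.intro left_module_hom_axioms.intro M.left_module_power N.left_module_power)
  fix x y assume "x \<in> carrier (power_module M n)" "y \<in> carrier (power_module M n)"
  then have "length x = n" "length y = n" "\<And>i. i < n \<Longrightarrow> x ! i \<in> carrier M" "\<And>i. i < n \<Longrightarrow> y ! i \<in> carrier M"
    by auto
  then show "map f (x \<oplus>\<^bsub>power_module M n\<^esub> y) = map f x \<oplus>\<^bsub>power_module N n\<^esub> map f y"
    by (intro nth_equalityI) (auto simp: add)
qed (auto simp: smult subset_iff)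

lemma (in left_module) nth_hom:
  assumes "i < n"
  shows "left_module_hom R (power_module M n) M (\<lambda>v. v ! i)"
  using assms
  by (intro left_module_hom.intro left_module_hom_axioms.intro left_module_axioms left_module_power) auto

lemma map2_concat:
  assumes "length vs = length ws" "\<forall>v\<in>set vs. length v = m" "\<forall>w\<in>set ws. length w = m"
  shows "concat (map2 (map2 g) vs ws) = map2 g (concat vs) (concat ws)"
  using assms by (induction vs ws rule: list_induct2) auto

lemma (in left_module) concat_hom:
  "left_module_hom R (power_module (power_module M m) n) (power_module M (m * n)) concat"
proof -
  interpret P: left_module R "power_module M m" by (rule left_module_power)
  show ?thesis
  proof (intro left_module_hom.intro left_module_hom_axioms.intro left_module_power P.left_module_power)
    fix x assume "x \<in> carrier (power_module (power_module M m) n)"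
    then show "concat x \<in> carrier (power_module M (m * n))"
      using bij_betw_concat_power_module[of M m n] bij_betwE by blast
  next
    fix x y assume "x \<in> carrier (power_module (power_module M m) n)"
      "y \<in> carrier (power_module (power_module M m) n)"
    then show "concat (x \<oplus>\<^bsub>power_module (power_module M m) n\<^esub> y) =
        concat x \<oplus>\<^bsub>power_module M (m * n)\<^esub> concat y"
      by (auto simp: subset_iff intro!: map2_concat[of _ _ m])
  qed (simp_all add: map_concat)
qed

text \<open>With blocks of equal length \<open>m\<close>, position \<open>i\<close> is entry
  \<open>i mod m\<close> of block \<open>i div m\<close>. All index computations for
  \<open>kronecker_one\<close> rest on this numbering.\<close>

lemma nth_concat_equal_length:
  assumes "\<forall>v\<in>set vs. length v = m" "i < m * length vs"
  shows "concat vs ! i = vs ! (i div m) ! (i mod m)"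
  using assms
proof (induction vs arbitrary: i)
  case (Cons v vs)
  show ?case
  proof (cases "i < m")
    case True
    then show ?thesis using Cons.prems by (simp add: nth_append)
  next
    case False
    then have "m > 0" using Cons.prems by (cases m) auto
    then have "i div m = Suc ((i - m) div m)" "i mod m = (i - m) mod m"
      using False by (simp_all add: le_div_geq le_mod_geq)
    then show ?thesis using Cons False by (simp add: nth_append)
  qed
qed simp

text \<open>An equality of records, since only the carrier of the power depends on the carrier of
  \<open>M\<close>. It makes the powers of \<open>M'\<close> restrictions of the powers of
  \<open>M^m\<close>.\<close>

lemma power_module_restrict:
  "power_module (M\<lparr>carrier := N\<rparr>) n = (power_module M n)\<lparr>carrier := {xs. length xs = n \<and> set xs \<subseteq> N}\<rparr>"
  by (simp add: power_module_def)

lemma map_image_lists_length: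
  "map f ` {xs. length xs = n \<and> set xs \<subseteq> A} = {ys. length ys = n \<and> set ys \<subseteq> f ` A}"
proof (intro equalityI subsetI)
  fix ys assume ys: "ys \<in> {ys. length ys = n \<and> set ys \<subseteq> f ` A}"
  then have "ys \<in> lists (f ` A)" by auto
  then have "ys \<in> map f ` lists A" unfolding lists_image .
  then obtain xs where "ys = map f xs" "set xs \<subseteq> A" by auto
  then show "ys \<in> map f ` {xs. length xs = n \<and> set xs \<subseteq> A}" using ys by auto
next
  fix ys assume "ys \<in> map f ` {xs. length xs = n \<and> set xs \<subseteq> A}"
  then obtain xs where "length xs = n" "set xs \<subseteq> A" "ys = map f xs" by blast
  then show "ys \<in> {ys. length ys = n \<and> set ys \<subseteq> f ` A}" by (simp add: image_mono)
qed

lemma (in left_module) lists_Sub: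
  assumes "N \<in> Sub R M"
  shows "{xs. length xs = n \<and> set xs \<subseteq> N} \<in> Sub R (power_module M n)"
proof -
  interpret P: left_module R "power_module M n" by (rule left_module_power)
  have N: "N \<subseteq> carrier M" "\<zero>\<^bsub>M\<^esub> \<in> N" "\<And>r x. r \<in> carrier R \<Longrightarrow> x \<in> N \<Longrightarrow> r \<odot>\<^bsub>M\<^esub> x \<in> N"
    using assms by (auto simp: Sub_iff)
  have add: "a \<oplus>\<^bsub>M\<^esub> b \<in> N" if "(a, b) \<in> set (zip x y)" "\<forall>t. t \<in> set x \<longrightarrow> t \<in> N" "\<forall>t. t \<in> set y \<longrightarrow> t \<in> N" for a b x y
    using assms that set_zip_leftD[OF that(1)] set_zip_rightD[OF that(1)] by (simp add: Sub_iff)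
  show ?thesis
    using N add unfolding P.Sub_iff by (auto simp: subset_iff)
qed

section \<open>Matrices acting on powers\<close>

lemma length_mat_vec [simp]: "length (mat_vec \<phi> M n A v) = n"
  by (simp add: mat_vec_def)

lemma nth_mat_vec:
  "i < n \<Longrightarrow> mat_vec \<phi> M n A v ! i = (\<Oplus>\<^bsub>M\<^esub>j\<in>{..<n}. \<phi> (A i j) \<odot>\<^bsub>M\<^esub> (v ! j))"
  by (simp add: mat_vec_def)

context left_module
begin

lemma mat_vec_terms:
  assumes "\<And>i j. i < n \<Longrightarrow> j < n \<Longrightarrow> \<phi> (A i j) \<in> carrier R"
    and "N \<in> Sub R M" "length v = n" "set v \<subseteq> N" "i < n"
  shows "(\<lambda>j. \<phi> (A i j) \<odot>\<^bsub>M\<^esub> (v ! j)) \<in> {..<n} \<rightarrow> N"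
proof (rule funcsetI)
  fix j assume "j \<in> {..<n}"
  then have "v ! j \<in> N" "\<phi> (A i j) \<in> carrier R" using assms(1,3,4,5) nth_mem[of j v] by auto
  then show "\<phi> (A i j) \<odot>\<^bsub>M\<^esub> (v ! j) \<in> N" using assms(2) by (simp add: Sub_iff)
qed

lemma mat_vec_closed:
  assumes "\<And>i j. i < n \<Longrightarrow> j < n \<Longrightarrow> \<phi> (A i j) \<in> carrier R"
    and "N \<in> Sub R M" "length v = n" "set v \<subseteq> N"
  shows "set (mat_vec \<phi> M n A v) \<subseteq> N"
  using Sub_finsum[OF assms(2) mat_vec_terms[where \<phi> = \<phi> and A = A, OF assms]]
  by (auto simp: mat_vec_def)

lemma mat_vec_restrict:
  assumes "\<And>i j. i < n \<Longrightarrow> j < n \<Longrightarrow> \<phi> (A i j) \<in> carrier R"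
    and "N \<in> Sub R M" "length v = n" "set v \<subseteq> N"
  shows "mat_vec \<phi> (M\<lparr>carrier := N\<rparr>) n A v = mat_vec \<phi> M n A v"
  using finsum_restrict[OF assms(2) mat_vec_terms[where \<phi> = \<phi> and A = A, OF assms]]
  by (simp add: mat_vec_def)

end

lemma (in left_module_hom) mat_vec_map:
  assumes "\<And>i j. i < n \<Longrightarrow> j < n \<Longrightarrow> \<phi> (A i j) \<in> carrier R" "v \<in> carrier (power_module M n)"
  shows "mat_vec \<phi> N n A (map f v) = map f (mat_vec \<phi> M n A v)"
proof (rule nth_equalityI)
  fix i assume "i < length (mat_vec \<phi> N n A (map f v))"
  then have i: "i < n" by simp
  have v: "v ! j \<in> carrier M" if "j < n" for j using assms(2) that by auto
  have "(\<lambda>j. \<phi> (A i j) \<odot>\<^bsub>M\<^esub> (v ! j)) \<in> {..<n} \<rightarrow> carrier M"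
    using assms(1) i v by auto
  then have "f (\<Oplus>\<^bsub>M\<^esub>j\<in>{..<n}. \<phi> (A i j) \<odot>\<^bsub>M\<^esub> (v ! j)) =
      (\<Oplus>\<^bsub>N\<^esub>j\<in>{..<n}. f (\<phi> (A i j) \<odot>\<^bsub>M\<^esub> (v ! j)))"
    by (rule finsum)
  also have "\<dots> = (\<Oplus>\<^bsub>N\<^esub>j\<in>{..<n}. \<phi> (A i j) \<odot>\<^bsub>N\<^esub> (map f v ! j))"
    using assms i v by (intro N.finsum_cong') (auto simp: smult)
  finally show "mat_vec \<phi> N n A (map f v) ! i = map f (mat_vec \<phi> M n A v) ! i"
    using i by (simp add: nth_mat_vec)
qed simp

section \<open>Kronecker products with an identity matrix\<close>

lemma (in abelian_monoid) finsum_residue_class: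
  fixes m n r :: nat
  assumes "r < m" "g \<in> {..<m * n} \<rightarrow> carrier G"
    and "\<And>k. k < m * n \<Longrightarrow> k mod m \<noteq> r \<Longrightarrow> g k = \<zero>"
  shows "finsum G g {..<m * n} = (\<Oplus>q\<in>{..<n}. g (q * m + r))"
proof -
  let ?h = "\<lambda>q. q * m + r"
  have sub: "?h ` {..<n} \<subseteq> {..<m * n}"
  proof clarsimp
    fix q assume "q < n"
    then have "Suc q * m \<le> n * m" by (intro mult_le_mono1) simp
    then show "q * m + r < m * n" using assms(1) by (simp add: mult.commute)
  qed
  have mem: "k \<in> ?h ` {..<n}" if "k < m * n" "k mod m = r" for k
    using that by (intro image_eqI[of _ _ "k div m"]) (auto simp: less_mult_imp_div_less mult.commute)
  have zero: "g k = \<zero>" if "k \<in> {..<m * n} - ?h ` {..<n}" for k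
    using that assms(3)[of k] mem[of k] by blast
  \<comment> \<open>The indices congruent to \<open>r\<close> modulo \<open>m\<close> are exactly
    the values of \<open>?h\<close>, and all other terms vanish.\<close>
  have "finsum G g {..<m * n} = finsum G g (?h ` {..<n})"
    using assms(2) sub zero by (intro add.finprod_mono_neutral_cong_right) auto
  also have "\<dots> = (\<Oplus>q\<in>{..<n}. g (?h q))"
    using assms(1,2) sub by (intro finsum_reindex) (auto simp: inj_on_def)
  finally show ?thesis .
qed

text \<open>
  The matrix \<open>A \<otimes> 1\<^sub>m\<close>, acting on \<open>M\<^bsup>mn\<^esup>\<close> as \<open>A\<close> acts on \<open>(M\<^sup>m)\<^sup>n\<close>.
\<close>

definition kronecker_one ::
  "('k, 'p) ring_scheme \<Rightarrow> nat \<Rightarrow> (nat \<Rightarrow> nat \<Rightarrow> 'k) \<Rightarrow> nat \<Rightarrow> nat \<Rightarrow> 'k" where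
  "kronecker_one F m A i j = (if i mod m = j mod m then A (i div m) (j div m) else \<zero>\<^bsub>F\<^esub>)"

lemma div_less_of_less_mult: "i < m * n \<Longrightarrow> i div m < (n::nat)"
  by (simp add: less_mult_imp_div_less mult.commute)

text \<open>Only indices \<open>k\<close> with the residue of \<open>i\<close> contribute. The sum
  over them is entry \<open>(i div m, j div m)\<close> of the product of \<open>A\<close> and
  \<open>B\<close> if \<open>i\<close> and \<open>j\<close> have equal residues, and zero
  otherwise.\<close>

lemma (in ring) kronecker_one_product:
  assumes A: "A \<in> matrices R n" and B: "B \<in> matrices R n" and "m > 0"
    and prod: "\<forall>i<n. \<forall>j<n. (\<Oplus>k\<in>{..<n}. A i k \<otimes> B k j) = (if i = j then \<one> else \<zero>)"
    and ij: "i < m * n" "j < m * n"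
  shows "(\<Oplus>k\<in>{..<m * n}. kronecker_one R m A i k \<otimes> kronecker_one R m B k j) =
    (if i = j then \<one> else \<zero>)"
proof -
  have dij: "i div m < n" "j div m < n" using ij by (auto intro: div_less_of_less_mult)
  have cl: "A (i div m) q \<in> carrier R" "B q (j div m) \<in> carrier R" if "q < n" for q
    using A B dij that by (auto simp: matrices_def)
  have cl': "kronecker_one R m A i k \<in> carrier R" "kronecker_one R m B k j \<in> carrier R" if "k < m * n" for k
    using cl[of "k div m"] div_less_of_less_mult[OF that] by (auto simp: kronecker_one_def)
  have "(\<Oplus>k\<in>{..<m * n}. kronecker_one R m A i k \<otimes> kronecker_one R m B k j) =
      (\<Oplus>q\<in>{..<n}. kronecker_one R m A i (q * m + i mod m) \<otimes> kronecker_one R m B (q * m + i mod m) j)"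
    using cl' \<open>m > 0\<close> by (intro finsum_residue_class) (auto simp: kronecker_one_def)
  also have "\<dots> = (\<Oplus>q\<in>{..<n}. if i mod m = j mod m then A (i div m) q \<otimes> B q (j div m) else \<zero>)"
    using cl \<open>m > 0\<close> by (intro finsum_cong') (auto simp: kronecker_one_def)
  also have "\<dots> = (if i = j then \<one> else \<zero>)"
  proof (cases "i mod m = j mod m")
    case True
    then have "i = j \<longleftrightarrow> i div m = j div m" by (metis div_mult_mod_eq)
    then show ?thesis using True prod dij by simp
  qed auto
  finally show ?thesis .
qed

text \<open>The inverse is the Kronecker product of the inverse of \<open>A\<close> with the
  identity. Invertibility matters because a directory morphism is equivariant only under
  \<open>GL\<close>.\<close>

lemma (in ring) kronecker_one_GL:
  assumes "A \<in> GL n R" "m > 0"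
  shows "kronecker_one R m A \<in> GL (m * n) R"
proof -
  obtain B where A: "A \<in> matrices R n" and B: "B \<in> matrices R n" and inv: "mutually_inverse R n A B"
    using assms(1) by (auto simp: GL_def)
  have "kronecker_one R m C \<in> matrices R (m * n)" if "C \<in> matrices R n" for C
    using that by (auto simp: matrices_def kronecker_one_def div_less_of_less_mult)
  moreover have "mutually_inverse R (m * n) (kronecker_one R m A) (kronecker_one R m B)"
    using kronecker_one_product[OF A B assms(2)] kronecker_one_product[OF B A assms(2)] inv
    by (simp add: mutually_inverse_def)
  ultimately show ?thesis using A B by (auto simp: GL_def)
qed

text \<open>In coordinate \<open>i\<close> of the left side, the zero entries of the Kronecker
  product discard all residues other than \<open>i mod m\<close>. What remains is coordinate
  \<open>i mod m\<close> of block \<open>i div m\<close> of the result of \<open>A\<close>.\<close>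

lemma (in left_module) mat_vec_kronecker_one:
  assumes \<phi>: "\<And>i j. i < n \<Longrightarrow> j < n \<Longrightarrow> \<phi> (A i j) \<in> carrier R" "\<phi> \<zero>\<^bsub>F\<^esub> = \<zero>\<^bsub>R\<^esub>"
    and "m > 0" and vs: "vs \<in> carrier (power_module (power_module M m) n)"
  shows "mat_vec \<phi> M (m * n) (kronecker_one F m A) (concat vs) =
    concat (mat_vec \<phi> (power_module M m) n A vs)"
proof (rule nth_equalityI)
  let ?P = "power_module M m"
  interpret P: left_module R ?P by (rule left_module_power)
  have len: "length vs = n" "\<forall>v\<in>set vs. length v = m" using vs by auto
  have cl: "vs ! q ! r \<in> carrier M" if "q < n" "r < m" for q r
  proof -
    have "vs ! q \<in> set vs" using that len by simp
    then have "vs ! q \<in> carrier ?P" using vs by auto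
    then show ?thesis using that by auto
  qed
  have w: "set (mat_vec \<phi> ?P n A vs) \<subseteq> carrier ?P"
    using vs by (intro P.mat_vec_closed \<phi> P.carrier_Sub) auto
  then have wlen: "\<forall>v\<in>set (mat_vec \<phi> ?P n A vs). length v = m" by auto
  have "mat_vec \<phi> ?P n A vs \<in> carrier (power_module ?P n)" using w by simp
  then have "concat (mat_vec \<phi> ?P n A vs) \<in> carrier (power_module M (m * n))"
    using bij_betw_concat_power_module[of M m n] bij_betwE by blast
  then show "length (mat_vec \<phi> M (m * n) (kronecker_one F m A) (concat vs)) =
      length (concat (mat_vec \<phi> ?P n A vs))" by simp
  fix i assume "i < length (mat_vec \<phi> M (m * n) (kronecker_one F m A) (concat vs))"
  then have i: "i < m * n" by simp
  then have di: "i div m < n" "i mod m < m" using div_less_of_less_mult[OF i] \<open>m > 0\<close> by auto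
  \<comment> \<open>Reading off a coordinate is linear, so it commutes with the finite sum formed in
    \<open>M^m\<close>.\<close>
  interpret nth: left_module_hom R ?P M "\<lambda>v. v ! (i mod m)" by (rule nth_hom[OF di(2)])
  let ?g = "\<lambda>k. \<phi> (kronecker_one F m A i k) \<odot>\<^bsub>M\<^esub> (concat vs ! k)"
  have concat_nth: "concat vs ! k = vs ! (k div m) ! (k mod m)" if "k < m * n" for k
    using nth_concat_equal_length[OF len(2)] that len(1) by simp
  have g: "?g k = (if i mod m = k mod m then \<phi> (A (i div m) (k div m)) \<odot>\<^bsub>M\<^esub> (vs ! (k div m) ! (k mod m)) else \<zero>\<^bsub>M\<^esub>)"
    if "k < m * n" for k
    using that cl[of "k div m" "k mod m"] div_less_of_less_mult[OF that] \<open>m > 0\<close>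
    by (simp add: kronecker_one_def concat_nth \<phi>(2))
  have lt: "q * m + i mod m < m * n" if "q < n" for q
  proof -
    have "Suc q * m \<le> n * m" using that by (intro mult_le_mono1) simp
    then show ?thesis using di(2) by (simp add: mult.commute)
  qed
  have "(\<Oplus>\<^bsub>M\<^esub>k\<in>{..<m * n}. ?g k) = (\<Oplus>\<^bsub>M\<^esub>q\<in>{..<n}. ?g (q * m + i mod m))"
    using g cl di \<phi>(1) div_less_of_less_mult \<open>m > 0\<close> by (intro M.finsum_residue_class) auto
  also have "\<dots> = (\<Oplus>\<^bsub>M\<^esub>q\<in>{..<n}. (\<phi> (A (i div m) q) \<odot>\<^bsub>?P\<^esub> (vs ! q)) ! (i mod m))"
    using g lt cl di \<phi>(1) \<open>m > 0\<close> len by (intro M.finsum_cong') auto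
  also have "\<dots> = (\<Oplus>\<^bsub>?P\<^esub>q\<in>{..<n}. \<phi> (A (i div m) q) \<odot>\<^bsub>?P\<^esub> (vs ! q)) ! (i mod m)"
    using vs di \<phi>(1) by (intro nth.finsum[symmetric] P.mat_vec_terms P.carrier_Sub) auto
  also have "\<dots> = concat (mat_vec \<phi> ?P n A vs) ! i"
    using nth_concat_equal_length[OF wlen] i di by (simp add: nth_mat_vec)
  finally show "mat_vec \<phi> M (m * n) (kronecker_one F m A) (concat vs) ! i =
      concat (mat_vec \<phi> ?P n A vs) ! i"
    using i by (simp add: nth_mat_vec)
qed

section \<open>Subsets of \<open>(M^m)^n\<close> and of \<open>M^(mn)\<close>\<close>

lemma regroup_concat_image:
  assumes "Z \<subseteq> carrier (power_module (power_module M m) n)"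
  shows "regroup M m n (concat ` Z) = Z"
proof -
  have "inj_on concat (carrier (power_module (power_module M m) n))"
    using bij_betw_concat_power_module by (rule bij_betw_imp_inj_on)
  then have "concat vs \<in> concat ` Z \<longleftrightarrow> vs \<in> Z" if "vs \<in> carrier (power_module (power_module M m) n)" for vs
    using that assms by (rule inj_on_image_mem_iff)
  then show ?thesis using assms unfolding regroup_def by blast
qed

text \<open>This direction uses surjectivity of \<open>concat\<close>, the preceding one its
  injectivity. Together they make \<open>regroup\<close> and the image under \<open>concat\<close>
  mutually inverse on subsets.\<close>

lemma concat_regroup_image:
  assumes "X \<subseteq> carrier (power_module M (m * n))"
  shows "concat ` regroup M m n X = X"
proof -
  have "X \<subseteq> concat ` carrier (power_module (power_module M m) n)"
    using assms bij_betw_concat_power_module[of M m n] by (simp add: bij_betw_def)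
  then show ?thesis unfolding regroup_def by blast
qed

text \<open>The last block is split off, so that the right side has the shape of \<open>osum\<close>
  and the direct sum of copies of \<open>X\<close> can be treated by induction.\<close>

lemma concat_image_lists_Suc:
  "concat ` {xs. length xs = Suc n \<and> set xs \<subseteq> X} =
    {u @ v | u v. u \<in> concat ` {xs. length xs = n \<and> set xs \<subseteq> X} \<and> v \<in> X}"
proof (intro equalityI subsetI)
  fix z assume "z \<in> concat ` {xs. length xs = Suc n \<and> set xs \<subseteq> X}"
  then obtain xs where xs: "length xs = Suc n" "set xs \<subseteq> X" "z = concat xs" by blast
  then obtain ys y where "xs = ys @ [y]" by (metis length_Suc_conv_rev)
  with xs show "z \<in> {u @ v | u v. u \<in> concat ` {xs. length xs = n \<and> set xs \<subseteq> X} \<and> v \<in> X}" by auto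
next
  fix z assume "z \<in> {u @ v | u v. u \<in> concat ` {xs. length xs = n \<and> set xs \<subseteq> X} \<and> v \<in> X}"
  then obtain xs v where xs: "length xs = n" "set xs \<subseteq> X" "v \<in> X" "z = concat xs @ v" by blast
  then show "z \<in> concat ` {xs. length xs = Suc n \<and> set xs \<subseteq> X}"
    by (intro image_eqI[of _ _ "xs @ [v]"]) auto
qed

lemma concat_image_append:
  "concat ` {x @ y | x y. x \<in> X \<and> y \<in> Y} = {x @ y | x y. x \<in> concat ` X \<and> y \<in> concat ` Y}"
proof (intro equalityI subsetI)
  fix z assume "z \<in> concat ` {x @ y | x y. x \<in> X \<and> y \<in> Y}"
  then obtain x y where "x \<in> X" "y \<in> Y" "z = concat x @ concat y" by auto
  then show "z \<in> {x @ y | x y. x \<in> concat ` X \<and> y \<in> concat ` Y}" by blast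
next
  fix z assume "z \<in> {x @ y | x y. x \<in> concat ` X \<and> y \<in> concat ` Y}"
  then obtain x y where "x \<in> X" "y \<in> Y" "z = concat (x @ y)" by auto
  then show "z \<in> concat ` {x @ y | x y. x \<in> X \<and> y \<in> Y}" by blast
qed

section \<open>Inflators and their mutations\<close>

lemma weak_partial_order_subset:
  "weak_partial_order \<lparr>carrier = S, eq = (=), le = (\<subseteq>)\<rparr>"
  by unfold_locales auto

text \<open>Besides monotonicity, \<open>isotone\<close> demands that both sorts be partial orders,
  which holds for inclusion.\<close>

lemma directory_morphism_Dir_iff:
  "directory_morphism F (Dir \<phi> R M) (Dir \<psi> S N) f \<longleftrightarrow>
    (\<forall>n\<ge>1. (\<forall>V\<in>Sub R (power_module M n). f n V \<in> Sub S (power_module N n)) \<and>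
       (\<forall>V\<in>Sub R (power_module M n). \<forall>W\<in>Sub R (power_module M n). V \<subseteq> W \<longrightarrow> f n V \<subseteq> f n W)) \<and>
    (\<forall>n\<ge>1. \<forall>A\<in>GL n F. \<forall>V\<in>Sub R (power_module M n).
       f n (mat_vec \<phi> M n A ` V) = mat_vec \<psi> N n A ` f n V) \<and>
    (\<forall>n\<ge>1. \<forall>m\<ge>1. \<forall>V\<in>Sub R (power_module M n). \<forall>W\<in>Sub R (power_module M m).
       f (n + m) {x @ y | x y. x \<in> V \<and> y \<in> W} = {x @ y | x y. x \<in> f n V \<and> y \<in> f m W})"
  unfolding directory_morphism_def Dir_def isotone_def
  by (simp add: weak_partial_order_subset Pi_iff)

lemma concat_image_lists_one: "concat ` {xs. length xs = Suc 0 \<and> set xs \<subseteq> X} = X"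
proof -
  have "{xs. length xs = 0 \<and> set xs \<subseteq> X} = {[]}" by auto
  then show ?thesis unfolding concat_image_lists_Suc by simp
qed

section \<open>The line spanned by \<open>a\<close>, and tensoring with it\<close>

locale line_in_power = field K for K (structure) +
  fixes m :: nat and a :: "'a list"
  assumes a_closed: "a \<in> carrier (vec_space K m)" and a_nonzero: "a \<noteq> replicate m \<zero>"
begin

text \<open>The map c -> c a, with the factors in the order used by \<open>line_tensor\<close>.
  Commutativity of \<open>K\<close> relates it to scalar multiplication in
  \<open>line_eq\<close>.\<close>

definition "scale c = map (\<lambda>x. x \<otimes> c) a"

lemma length_a: "length a = m" and nth_a: "i < m \<Longrightarrow> a ! i \<in> carrier K"
  using a_closed by auto

text \<open>For \<open>m = 0\<close> the empty list is the only vector, and it is zero. Positivity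
  ensures that \<open>m\<close> and \<open>m * n\<close> index genuine sorts of the
  directory.\<close>

lemma m_pos: "m > 0"
  using length_a a_nonzero by (cases m) auto

lemma scale_hom: "left_module_hom K (regular_module K) (vec_space K m) scale"
proof -
  interpret reg: left_module K "regular_module K" by (rule left_module_regular)
  show ?thesis
    using a_closed
    by (intro left_module_hom.intro left_module_hom_axioms.intro reg.left_module_power reg.left_module_axioms)
       (auto intro!: nth_equalityI simp: scale_def r_distr m_lcomm nth_a subset_iff)
qed

lemma inj_scale: "inj_on scale (carrier K)"
proof (rule inj_onI)
  obtain j where j: "j < m" "a ! j \<noteq> \<zero>"
    using a_nonzero length_a by (metis length_replicate nth_equalityI nth_replicate)
  fix c c' assume c: "c \<in> carrier K" "c' \<in> carrier K" "scale c = scale c'"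
  then have "scale c ! j = scale c' ! j" by simp
  then have "a ! j \<otimes> c = a ! j \<otimes> c'" using j(1) length_a by (simp add: scale_def)
  then show "c = c'" using m_lcancel[OF j(2) nth_a[OF j(1)]] c by blast
qed

lemma line_eq: "{c \<odot>\<^bsub>vec_space K m\<^esub> a | c. c \<in> carrier K} = scale ` carrier K"
proof -
  have "c \<odot>\<^bsub>vec_space K m\<^esub> a = scale c" if "c \<in> carrier K" for c
    using a_closed that by (auto simp: scale_def m_comm subset_iff)
  then have "(\<lambda>c. c \<odot>\<^bsub>vec_space K m\<^esub> a) ` carrier K = scale ` carrier K" by (rule image_cong[OF refl])
  then show ?thesis by (simp only: setcompr_eq_image Collect_mem_eq)
qed

lemma line_tensor_eq: "line_tensor K a V = concat ` map scale ` V"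
  unfolding line_tensor_def image_image scale_def ..

lemma line_tensor_hom:
  "left_module_hom K (vec_space K n) (vec_space K (m * n)) (\<lambda>x. concat (map scale x))"
proof -
  interpret reg: left_module K "regular_module K" by (rule left_module_regular)
  interpret left_module_hom K "regular_module K" "vec_space K m" scale by (rule scale_hom)
  show ?thesis by (rule left_module_hom_comp[OF map_hom reg.concat_hom])
qed

lemma inj_line_tensor: "inj_on (\<lambda>x. concat (map scale x)) (carrier (vec_space K n))"
proof -
  interpret left_module_hom K "regular_module K" "vec_space K m" scale by (rule scale_hom)
  interpret maps: left_module_hom K "vec_space K n" "power_module (vec_space K m) n" "map scale"
    by (rule map_hom)
  have "inj_on (map scale) (carrier (vec_space K n))"
  proof (rule inj_onI)
    fix x y assume "x \<in> carrier (vec_space K n)" "y \<in> carrier (vec_space K n)" "map scale x = map scale y"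
    then show "x = y" using inj_on_subset[OF inj_scale] by (intro map_inj_on[of scale x y]) auto
  qed
  moreover have "inj_on concat (map scale ` carrier (vec_space K n))"
    using bij_betw_imp_inj_on[OF bij_betw_concat_power_module] maps.closed
    by (rule inj_on_subset[OF _ image_subsetI])
  ultimately have "inj_on (concat \<circ> map scale) (carrier (vec_space K n))" by (rule comp_inj_on)
  then show ?thesis by (simp add: comp_def)
qed

lemma line_tensor_Sub:
  assumes "V \<in> Sub K (vec_space K n)"
  shows "line_tensor K a V \<in> Sub K (vec_space K (m * n))"
  using left_module_hom.image_Sub[OF line_tensor_hom assms] by (simp add: line_tensor_eq image_image)

lemma dim_line_tensor:
  assumes "V \<in> Sub K (vec_space K n)"
  shows "vectorspace.dim K ((vec_space K (m * n))\<lparr>carrier := line_tensor K a V\<rparr>) =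
    vectorspace.dim K ((vec_space K n)\<lparr>carrier := V\<rparr>)"
proof (rule dim_iso[symmetric])
  let ?h = "\<lambda>x. concat (map scale x)"
  interpret h: left_module_hom K "vec_space K n" "vec_space K (m * n)" ?h by (rule line_tensor_hom)
  have V: "V \<subseteq> carrier (vec_space K n)" using assms by (simp add: h.M.Sub_iff)
  have im: "?h ` V = line_tensor K a V" by (simp add: line_tensor_eq image_image)
  show "left_module_hom K ((vec_space K n)\<lparr>carrier := V\<rparr>)
      ((vec_space K (m * n))\<lparr>carrier := line_tensor K a V\<rparr>) ?h"
    using h.restrict[OF assms line_tensor_Sub[OF assms]] im by blast
  show "bij_betw ?h (carrier ((vec_space K n)\<lparr>carrier := V\<rparr>))
      (carrier ((vec_space K (m * n))\<lparr>carrier := line_tensor K a V\<rparr>))"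
    using inj_on_subset[OF inj_line_tensor V] im by (simp add: bij_betw_def)
qed (rule field_axioms)

text \<open>Linearity of \<open>scale\<close> lets \<open>A\<close> act on the blocks instead of the
  scalars, and \<open>concat\<close> turns that action into the one of the Kronecker
  product.\<close>

lemma line_tensor_mat_vec:
  assumes "A \<in> GL n (K\<lparr>carrier := K\<^sub>0\<rparr>)" "K\<^sub>0 \<subseteq> carrier K" "V \<in> Sub K (vec_space K n)"
  shows "line_tensor K a (mat_vec (\<lambda>c. c) (regular_module K) n A ` V) =
    mat_vec (\<lambda>c. c) (regular_module K) (m * n) (kronecker_one (K\<lparr>carrier := K\<^sub>0\<rparr>) m A) ` line_tensor K a V"
proof -
  interpret reg: left_module K "regular_module K" by (rule left_module_regular)
  interpret scale: left_module_hom K "regular_module K" "vec_space K m" scale by (rule scale_hom)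
  interpret maps: left_module_hom K "vec_space K n" "power_module (vec_space K m) n" "map scale"
    by (rule scale.map_hom)
  have A: "A i j \<in> carrier K" if "i < n" "j < n" for i j
    using that assms(1,2) by (auto simp: GL_def matrices_def)
  have "concat (map scale (mat_vec (\<lambda>c. c) (regular_module K) n A v)) =
      mat_vec (\<lambda>c. c) (regular_module K) (m * n) (kronecker_one (K\<lparr>carrier := K\<^sub>0\<rparr>) m A)
        (concat (map scale v))" if "v \<in> V" for v
  proof -
    have "V \<subseteq> carrier (vec_space K n)" using assms(3) by (simp only: maps.M.Sub_iff)
    then have v: "v \<in> carrier (vec_space K n)" using that by blast
    show ?thesis
      using scale.mat_vec_map[where \<phi> = "\<lambda>c. c", OF A v]
        reg.mat_vec_kronecker_one[where \<phi> = "\<lambda>c. c" and F = "K\<lparr>carrier := K\<^sub>0\<rparr>", OF A _ m_pos maps.closed[OF v]]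
      by simp
  qed
  then show ?thesis unfolding line_tensor_eq image_image by (rule image_cong[OF refl])
qed

lemma line_tensor_append:
  "line_tensor K a {x @ y | x y. x \<in> V \<and> y \<in> W} =
    {x @ y | x y. x \<in> line_tensor K a V \<and> y \<in> line_tensor K a W}"
proof -
  have "map scale ` {x @ y | x y. x \<in> V \<and> y \<in> W} =
      {x @ y | x y. x \<in> map scale ` V \<and> y \<in> map scale ` W}"
  proof (intro equalityI subsetI)
    fix z assume "z \<in> map scale ` {x @ y | x y. x \<in> V \<and> y \<in> W}"
    then obtain x y where "x \<in> V" "y \<in> W" "z = map scale x @ map scale y" by auto
    then show "z \<in> {x @ y | x y. x \<in> map scale ` V \<and> y \<in> map scale ` W}" by blast
  next
    fix z assume "z \<in> {x @ y | x y. x \<in> map scale ` V \<and> y \<in> map scale ` W}"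
    then obtain x y where "x \<in> V" "y \<in> W" "z = map scale (x @ y)" by auto
    then show "z \<in> map scale ` {x @ y | x y. x \<in> V \<and> y \<in> W}" by blast
  qed
  then show ?thesis unfolding line_tensor_eq by (simp only: concat_image_append)
qed

text \<open>Tensoring all of \<open>K^n\<close> with the line gives the direct sum of
  \<open>n\<close> copies of the line, the starting point for computing \<open>\<zeta>\<close> on
  it.\<close>

lemma line_tensor_carrier:
  "line_tensor K a (carrier (vec_space K n)) =
    concat ` {xs. length xs = n \<and> set xs \<subseteq> scale ` carrier K}"
  unfolding line_tensor_eq by (simp add: map_image_lists_length)

end

theorem theorem10p1:
  fixes K :: "('k, 'p) ring_scheme" and K\<^sub>0 :: "'k set"
    and R :: "('r, 'q) ring_scheme" and \<phi> :: "'k \<Rightarrow> 'r"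
    and M :: "('r, 'm, 's) module_scheme" and d m :: nat
    and \<zeta> :: "nat \<Rightarrow> 'k list set \<Rightarrow> 'm list set"
    and a :: "'k list" and L :: "'k list set" and M' :: "('r, 'm list) module"
  assumes "field K" and "subfield K\<^sub>0 K" and "infinite K\<^sub>0"
    and "algebra_over (K\<lparr>carrier := K\<^sub>0\<rparr>) \<phi> R" and "semisimple_ring R"
    and "left_module R M" and "module_length R M = enat d"
    and "inflator K\<^sub>0 K \<phi> R M d \<zeta>"
    and "a \<in> carrier (vec_space K m)"
    and "L = {c \<odot>\<^bsub>vec_space K m\<^esub> a | c. c \<in> carrier K}"
    and "vectorspace.dim K ((vec_space K m)\<lparr>carrier := L\<rparr>) = 1"
    and "M' = (power_module M m)\<lparr>carrier := \<zeta> m L\<rparr>"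
  shows "\<zeta> m L \<in> Sub R (power_module M m) \<and>
    (\<forall>n\<ge>1. \<forall>V\<in>Sub K (vec_space K n). mutation K M m a \<zeta> n V \<in> Sub R (power_module M' n)) \<and>
    inflator K\<^sub>0 K \<phi> R M' d (mutation K M m a \<zeta>)"
proof -
  let ?F = "K\<lparr>carrier := K\<^sub>0\<rparr>" and ?k = "regular_module K" and ?P = "power_module M m"
  interpret field K by fact
  interpret M: left_module R M by fact
  interpret P: left_module R ?P by (rule M.left_module_power)
  interpret k: left_module K ?k by (rule left_module_regular)
  interpret km: left_module K "vec_space K m" by (rule k.left_module_power)
  have "ring ?F" and hom: "\<phi> \<in> ring_hom ?F R" and "K\<^sub>0 \<subseteq> carrier K"
    using assms(2,4) by (auto simp: algebra_over_def field.is_ring dest: subfieldE(3))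
  interpret F: ring ?F by fact
  have \<phi>_zero: "\<phi> \<zero>\<^bsub>?F\<^esub> = \<zero>\<^bsub>R\<^esub>"
    using ring_hom_zero[OF hom F.ring_axioms M.R.ring_axioms] .
  have \<phi>_GL: "\<phi> (A i j) \<in> carrier R" if "A \<in> GL n ?F" "i < n" "j < n" for A n i j
    using that ring_hom_closed[OF hom] by (auto simp: GL_def matrices_def)

  \<comment> \<open>A zero vector would span the zero space, whose dimension is 0 and not 1.\<close>
  have "a \<noteq> replicate m \<zero>\<^bsub>K\<^esub>"
  proof
    assume "a = replicate m \<zero>\<^bsub>K\<^esub>"
    then have "c \<odot>\<^bsub>vec_space K m\<^esub> a = \<zero>\<^bsub>vec_space K m\<^esub>" if "c \<in> carrier K" for c
      using that by simp
    then have "(\<lambda>c. c \<odot>\<^bsub>vec_space K m\<^esub> a) ` carrier K = (\<lambda>c. \<zero>\<^bsub>vec_space K m\<^esub>) ` carrier K"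
      by (rule image_cong[OF refl])
    then have L: "L = {\<zero>\<^bsub>vec_space K m\<^esub>}"
      using carrier_not_empty by (simp only: assms(10) setcompr_eq_image Collect_mem_eq image_constant_conv if_False)
    interpret L: left_module K "(vec_space K m)\<lparr>carrier := L\<rparr>"
      unfolding L by (rule km.left_module_restrict[OF km.zero_Sub])
    interpret L: vectorspace K "(vec_space K m)\<lparr>carrier := L\<rparr>" by (rule L.vectorspaceI) fact
    have "L.dim = 0" using L by (intro L.dim_zero_space) simp
    then show False using assms(11) by simp
  qed
  then interpret line_in_power K m a using assms(9) by unfold_locales auto
  have L: "L = scale ` carrier K" using assms(10) line_eq by simp
  have "L \<in> Sub K (vec_space K m)"
    using left_module_hom.image_Sub[OF scale_hom k.carrier_Sub] L by simp

  have dir: "directory_morphism ?F (Dir_field K) (Dir \<phi> R M) \<zeta>" and "semisimple_module R M"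
    and \<zeta>_length: "\<And>n V. n \<ge> 1 \<Longrightarrow> V \<in> Sub K (vec_space K n) \<Longrightarrow>
        module_length R ((power_module M n)\<lparr>carrier := \<zeta> n V\<rparr>) =
        enat (d * vectorspace.dim K ((vec_space K n)\<lparr>carrier := V\<rparr>))"
    using assms(8) by (simp_all only: inflator_def)
  note dir = dir[unfolded directory_morphism_Dir_iff]
  have \<zeta>_Sub: "\<zeta> n V \<in> Sub R (power_module M n)"
    if "n \<ge> 1" "V \<in> Sub K (vec_space K n)" for n V
    using dir[THEN conjunct1] that by blast
  have \<zeta>_mono: "\<zeta> n V \<subseteq> \<zeta> n W"
    if "n \<ge> 1" "V \<in> Sub K (vec_space K n)" "W \<in> Sub K (vec_space K n)" "V \<subseteq> W" for n V W
    using dir[THEN conjunct1] that by blast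
  note \<zeta>_GL = dir[THEN conjunct2, THEN conjunct1, rule_format]
    and \<zeta>_append = dir[THEN conjunct2, THEN conjunct2, rule_format]

  have m: "m \<ge> 1" using m_pos by simp
  have mn: "m * n \<ge> 1" if "n \<ge> 1" for n using m that by (simp add: Suc_le_eq)
  have N: "\<zeta> m L \<in> Sub R ?P" using m \<open>L \<in> Sub K (vec_space K m)\<close> by (rule \<zeta>_Sub)
  interpret M': left_module R M' unfolding assms(12) by (rule P.left_module_restrict[OF N])
  \<comment> \<open>The power of \<open>M'\<close> as a submodule of \<open>(M^m)^n\<close>.\<close>
  define \<MM> where "\<MM> n = {xs. length xs = n \<and> set xs \<subseteq> \<zeta> m L}" for n
  have power_M': "power_module M' n = (power_module ?P n)\<lparr>carrier := \<MM> n\<rparr>" for n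
    unfolding assms(12) \<MM>_def by (rule power_module_restrict)
  have carrier_M': "carrier (power_module M' n) = \<MM> n" for n
    by (simp add: power_M')
  have \<MM>: "\<MM> n \<in> Sub R (power_module ?P n)" for n
    unfolding \<MM>_def using N by (rule P.lists_Sub)
  have \<MM>_closed: "\<MM> n \<subseteq> carrier (power_module ?P n)" for n
    using N unfolding \<MM>_def P.Sub_iff by auto

  have carrier_lt: "carrier (vec_space K n) \<in> Sub K (vec_space K n)" for n
    using left_module.carrier_Sub[OF k.left_module_power] .
  \<comment> \<open>Induction on the number of copies of \<open>L\<close>, each step using
    compatibility of \<open>\<zeta>\<close> with direct sums. It starts at 1, where the claim is
    about \<open>\<zeta> m L\<close> itself, because there is no sort of index 0.\<close>
  have \<zeta>_full: "\<zeta> (m * n) (line_tensor K a (carrier (vec_space K n))) = concat ` \<MM> n" if "n \<ge> 1" for n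
    using that
  proof (induction n rule: nat_induct_at_least)
    case base
    show ?case
      unfolding line_tensor_carrier \<MM>_def by (simp add: concat_image_lists_one L)
  next
    case (Suc n)
    have "\<zeta> (m * Suc n) (line_tensor K a (carrier (vec_space K (Suc n)))) =
        \<zeta> (m * n + m) {u @ v | u v. u \<in> line_tensor K a (carrier (vec_space K n)) \<and> v \<in> L}"
      unfolding line_tensor_carrier concat_image_lists_Suc L by (simp add: add.commute)
    also have "\<dots> = {u @ v | u v. u \<in> concat ` \<MM> n \<and> v \<in> \<zeta> m L}"
      unfolding Suc.IH[symmetric]
      by (rule \<zeta>_append[OF mn[OF Suc.hyps] m line_tensor_Sub[OF carrier_lt] \<open>L \<in> Sub K (vec_space K m)\<close>])
    also have "\<dots> = concat ` \<MM> (Suc n)" unfolding \<MM>_def concat_image_lists_Suc ..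
    finally show ?case .
  qed

  let ?\<mu> = "mutation K M m a \<zeta>"
  \<comment> \<open>The first part is monotonicity of \<open>\<zeta>\<close> below the full space.
    It permits viewing the mutation as the preimage of
    \<open>\<zeta> (m * n) (line_tensor K a V)\<close> under \<open>concat\<close> on the power of
    \<open>M'\<close>, hence as a submodule.\<close>
  have mut: "?\<mu> n V \<subseteq> \<MM> n" "concat ` ?\<mu> n V = \<zeta> (m * n) (line_tensor K a V)"
    "?\<mu> n V \<in> Sub R (power_module M' n)"
    if n: "n \<ge> 1" and V: "V \<in> Sub K (vec_space K n)" for n V
  proof -
    interpret Mmn: left_module R "power_module M (m * n)" by (rule M.left_module_power)
    interpret kn: left_module K "vec_space K n" by (rule k.left_module_power)
    let ?X = "\<zeta> (m * n) (line_tensor K a V)"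
    have X: "?X \<in> Sub R (power_module M (m * n))"
      using mn[OF n] line_tensor_Sub[OF V] by (rule \<zeta>_Sub)
    have "V \<subseteq> carrier (vec_space K n)" using V by (simp add: kn.Sub_iff)
    then have "line_tensor K a V \<subseteq> line_tensor K a (carrier (vec_space K n))"
      unfolding line_tensor_eq by (intro image_mono)
    then have "?X \<subseteq> concat ` \<MM> n"
      unfolding \<zeta>_full[OF n, symmetric]
      by (rule \<zeta>_mono[OF mn[OF n] line_tensor_Sub[OF V] line_tensor_Sub[OF carrier_lt]])
    then have "regroup M m n ?X \<subseteq> regroup M m n (concat ` \<MM> n)" unfolding regroup_def by blast
    then show sub: "?\<mu> n V \<subseteq> \<MM> n"
      unfolding mutation_def regroup_concat_image[OF \<MM>_closed] .
    show "concat ` ?\<mu> n V = ?X"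
      unfolding mutation_def using X by (intro concat_regroup_image) (simp only: Mmn.Sub_iff)
    interpret c: left_module_hom R "power_module M' n" "power_module M (m * n)" concat
      unfolding power_M' by (rule left_module_hom.restrict_domain[OF M.concat_hom \<MM>])
    have "?\<mu> n V = {vs \<in> carrier (power_module M' n). concat vs \<in> ?X}"
      using sub \<MM>_closed[of n] unfolding mutation_def regroup_def carrier_M' by blast
    also have "\<dots> \<in> Sub R (power_module M' n)" using X by (rule c.vimage_Sub)
    finally show "?\<mu> n V \<in> Sub R (power_module M' n)" .
  qed
  have mut_closed: "?\<mu> n V \<subseteq> carrier (power_module ?P n)"
    if n: "n \<ge> 1" and V: "V \<in> Sub K (vec_space K n)" for n V
    using mut(1)[OF that] \<MM>_closed by blast

  \<comment> \<open>Equivariance of \<open>\<zeta>\<close> is applied to the Kronecker product of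
    \<open>A\<close> with the identity, whose entries again lie in \<open>K\<^sub>0\<close>. The
    result is then read blockwise.\<close>
  have mut_GL: "?\<mu> n (mat_vec (\<lambda>c. c) ?k n A ` V) = mat_vec \<phi> M' n A ` ?\<mu> n V"
    if n: "n \<ge> 1" and A: "A \<in> GL n ?F" and V: "V \<in> Sub K (vec_space K n)" for n A V
  proof -
    have "\<zeta> (m * n) (line_tensor K a (mat_vec (\<lambda>c. c) ?k n A ` V)) =
        mat_vec \<phi> M (m * n) (kronecker_one ?F m A) ` concat ` ?\<mu> n V"
      unfolding mut(2)[OF n V] line_tensor_mat_vec[OF A \<open>K\<^sub>0 \<subseteq> carrier K\<close> V]
      by (rule \<zeta>_GL[OF mn[OF n] F.kronecker_one_GL[OF A m_pos] line_tensor_Sub[OF V]])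
    also have "\<dots> = concat ` mat_vec \<phi> ?P n A ` ?\<mu> n V"
      unfolding image_image
    proof (rule image_cong[OF refl])
      fix vs assume "vs \<in> ?\<mu> n V"
      then have "vs \<in> carrier (power_module ?P n)" using mut_closed[OF n V] by blast
      then show "mat_vec \<phi> M (m * n) (kronecker_one ?F m A) (concat vs) = concat (mat_vec \<phi> ?P n A vs)"
        using \<phi>_GL[OF A] \<phi>_zero m_pos by (intro M.mat_vec_kronecker_one)
    qed
    finally have *: "\<zeta> (m * n) (line_tensor K a (mat_vec (\<lambda>c. c) ?k n A ` V)) =
        concat ` mat_vec \<phi> ?P n A ` ?\<mu> n V" .
    have "mat_vec \<phi> ?P n A vs \<in> carrier (power_module ?P n)" if "vs \<in> ?\<mu> n V" for vs
    proof -
      have "vs \<in> carrier (power_module ?P n)" using that mut_closed[OF n V] by blast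
      then have "length vs = n" "set vs \<subseteq> carrier ?P" by simp_all
      then have "set (mat_vec \<phi> ?P n A vs) \<subseteq> carrier ?P"
        by (intro P.mat_vec_closed P.carrier_Sub \<phi>_GL[OF A])
      then show ?thesis by simp
    qed
    then have "?\<mu> n (mat_vec (\<lambda>c. c) ?k n A ` V) = mat_vec \<phi> ?P n A ` ?\<mu> n V"
      unfolding mutation_def[of K M m a \<zeta> n "mat_vec (\<lambda>c. c) ?k n A ` V"] *
      by (intro regroup_concat_image) blast
    \<comment> \<open>The sums in \<open>mat_vec\<close> move from \<open>M^m\<close> to the smaller
      carrier \<open>M'\<close>, where they have the same values.\<close>
    also have "\<dots> = mat_vec \<phi> M' n A ` ?\<mu> n V"
    proof (rule image_cong[OF refl])
      fix vs assume "vs \<in> ?\<mu> n V"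
      then have "vs \<in> \<MM> n" using mut(1)[OF n V] by blast
      then have "length vs = n" "set vs \<subseteq> \<zeta> m L" by (simp_all add: \<MM>_def)
      then show "mat_vec \<phi> ?P n A vs = mat_vec \<phi> M' n A vs"
        unfolding assms(12) by (intro P.mat_vec_restrict[symmetric] N \<phi>_GL[OF A])
    qed
    finally show ?thesis .
  qed

  have mut_append: "?\<mu> (n + l) {x @ y | x y. x \<in> V \<and> y \<in> W} =
      {x @ y | x y. x \<in> ?\<mu> n V \<and> y \<in> ?\<mu> l W}"
    if n: "n \<ge> 1" and l: "l \<ge> 1" and V: "V \<in> Sub K (vec_space K n)" and W: "W \<in> Sub K (vec_space K l)"
    for n l V W
  proof -
    have "\<zeta> (m * (n + l)) (line_tensor K a {x @ y | x y. x \<in> V \<and> y \<in> W}) =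
        concat ` {x @ y | x y. x \<in> ?\<mu> n V \<and> y \<in> ?\<mu> l W}"
      unfolding line_tensor_append concat_image_append mut(2)[OF n V] mut(2)[OF l W] distrib_left
      by (rule \<zeta>_append[OF mn[OF n] mn[OF l] line_tensor_Sub[OF V] line_tensor_Sub[OF W]])
    moreover have "{x @ y | x y. x \<in> ?\<mu> n V \<and> y \<in> ?\<mu> l W} \<subseteq> carrier (power_module ?P (n + l))"
    proof
      fix z assume "z \<in> {x @ y | x y. x \<in> ?\<mu> n V \<and> y \<in> ?\<mu> l W}"
      then obtain x y where z: "z = x @ y" and "x \<in> ?\<mu> n V" "y \<in> ?\<mu> l W" by blast
      then have "x \<in> carrier (power_module ?P n)" "y \<in> carrier (power_module ?P l)"
        using mut_closed[OF n V] mut_closed[OF l W] by blast+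
      then show "z \<in> carrier (power_module ?P (n + l))" unfolding z by simp
    qed
    ultimately show ?thesis
      unfolding mutation_def[of K M m a \<zeta> "n + l"] by (simp only: regroup_concat_image)
  qed

  \<comment> \<open>\<open>concat\<close> restricts to an isomorphism onto
    \<open>\<zeta> (m * n) (line_tensor K a V)\<close>, and tensoring with a line preserves the
    dimension.\<close>
  have mut_length: "module_length R ((power_module M' n)\<lparr>carrier := ?\<mu> n V\<rparr>) =
      enat (d * vectorspace.dim K ((vec_space K n)\<lparr>carrier := V\<rparr>))"
    if n: "n \<ge> 1" and V: "V \<in> Sub K (vec_space K n)" for n V
  proof -
    let ?X = "\<zeta> (m * n) (line_tensor K a V)"
    interpret c: left_module_hom R "power_module M' n" "power_module M (m * n)" concat
      unfolding power_M' by (rule left_module_hom.restrict_domain[OF M.concat_hom \<MM>])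
    have X: "?X \<in> Sub R (power_module M (m * n))"
      using mn[OF n] line_tensor_Sub[OF V] by (rule \<zeta>_Sub)
    have "left_module_hom R ((power_module M' n)\<lparr>carrier := ?\<mu> n V\<rparr>)
        ((power_module M (m * n))\<lparr>carrier := ?X\<rparr>) concat"
      using mut(2)[OF n V] by (intro c.restrict[OF mut(3)[OF n V] X]) simp
    moreover have "bij_betw concat (?\<mu> n V) ?X"
      unfolding bij_betw_def
      using mut(2)[OF n V] inj_on_subset[OF bij_betw_imp_inj_on[OF bij_betw_concat_power_module] mut_closed[OF n V]]
      by simp
    ultimately have "module_length R ((power_module M' n)\<lparr>carrier := ?\<mu> n V\<rparr>) =
        module_length R ((power_module M (m * n))\<lparr>carrier := ?X\<rparr>)"
      by (intro module_length_iso[of _ _ _ concat]) simp_all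
    also have "\<dots> = enat (d * vectorspace.dim K ((vec_space K n)\<lparr>carrier := V\<rparr>))"
      using \<zeta>_length[OF mn[OF n] line_tensor_Sub[OF V]] dim_line_tensor[OF V] by simp
    finally show ?thesis .
  qed

  \<comment> \<open>The length formula for \<open>\<zeta>\<close> in sort \<open>m\<close> at the
    line \<open>L\<close>, which has dimension 1.\<close>
  have length_M': "module_length R M' = enat d"
    using \<zeta>_length[OF m \<open>L \<in> Sub K (vec_space K m)\<close>] assms(11,12) by simp
  have "semisimple_module R M'"
    using M.semisimple_Sub_power[OF \<open>semisimple_module R M\<close> N] length_M' unfolding assms(12) by simp
  moreover have "directory_morphism ?F (Dir_field K) (Dir \<phi> R M') ?\<mu>"
    unfolding directory_morphism_Dir_iff
  proof (intro conjI allI ballI impI)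
    fix n V assume "n \<ge> (1::nat)" "V \<in> Sub K (vec_space K n)"
    then show "?\<mu> n V \<in> Sub R (power_module M' n)" by (rule mut(3))
  next
    fix n V W
    assume n: "n \<ge> (1::nat)" and VW: "V \<in> Sub K (vec_space K n)" "W \<in> Sub K (vec_space K n)" "V \<subseteq> W"
    then have "line_tensor K a V \<subseteq> line_tensor K a W" unfolding line_tensor_eq by (intro image_mono)
    then have "\<zeta> (m * n) (line_tensor K a V) \<subseteq> \<zeta> (m * n) (line_tensor K a W)"
      by (rule \<zeta>_mono[OF mn[OF n] line_tensor_Sub[OF VW(1)] line_tensor_Sub[OF VW(2)]])
    then show "?\<mu> n V \<subseteq> ?\<mu> n W" unfolding mutation_def regroup_def by blast
  next
    fix n A V assume "n \<ge> (1::nat)" "A \<in> GL n ?F" "V \<in> Sub K (vec_space K n)"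
    then show "?\<mu> n (mat_vec (\<lambda>c. c) ?k n A ` V) = mat_vec \<phi> M' n A ` ?\<mu> n V" by (rule mut_GL)
  next
    fix n l V W
    assume "n \<ge> (1::nat)" "l \<ge> (1::nat)" "V \<in> Sub K (vec_space K n)" "W \<in> Sub K (vec_space K l)"
    then show "?\<mu> (n + l) {x @ y | x y. x \<in> V \<and> y \<in> W} = {x @ y | x y. x \<in> ?\<mu> n V \<and> y \<in> ?\<mu> l W}"
      by (rule mut_append)
  qed
  ultimately have "inflator K\<^sub>0 K \<phi> R M' d ?\<mu>"
    unfolding inflator_def
    using assms(1,2,4) M'.left_module_axioms length_M' mut_length by (intro conjI) auto
  then show ?thesis using N mut(3) by blast
qed

end
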